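(* Let $T$ be a bimonad on a monoidal category $\mathcal{C}$. (a) Assume $\mathcal{C}$ is left autonomous. Then $T$ has a left antipode $s^l$ if and only if the category $T\text{-}\mathcal{C}$ of $T$-modules is left autonomous. Moreover, if a left antipode exists, then it is unique. In terms of a left antipode $s^l$, left duals in $T\text{-}\mathcal{C}$ are given by $${}^\vee(M,r)=({}^\vee M,\; s^l_M\,T({}^\vee r)),\quad \mathrm{ev}_{(M,r)}=\mathrm{ev}_M,\quad \mathrm{coev}_{(M,r)}=\mathrm{coev}_M .$$ (b) Assume $\mathcal{C}$ is right autonomous. Then $T$ has a right antipode $s^r$ if and only if the category $T\text{-}\mathcal{C}$ is right autonomous. Moreover, if a right antipode exists, then it is unique. In terms of a right antipode $s^r$, right duals in $T\text{-}\mathcal{C}$ are given by $$(M,r)^\vee=(M^\vee,\; s^r_M\,T(r^\vee)),\quad \widetilde{\mathrm{ev}}_{(M,r)}=\widetilde{\mathrm{ev}}_M,\quad \widetilde{\mathrm{coev}}_{(M,r)}=\widetilde{\mathrm{coev}}_M .$$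
   Context: Conventions: categories are small, monoidal categories $(\mathcal{C},\otimes,\mathbf 1)$ are strict; composition of $f$ followed by $g$ is written $gf$; "functorial" means natural. Monads: a monad on $\mathcal{C}$ is $(T,\mu\colon T^2\to T,\eta\colon 1_{\mathcal C}\to T)$ with $\mu_XT(\mu_X)=\mu_X\mu_{T(X)}$, $\mu_X\eta_{T(X)}=\mathrm{id}_{T(X)}=\mu_XT(\eta_X)$. A $T$-module is $(M,r)$ with $r\colon T(M)\to M$, $rT(r)=r\mu_M$, $r\eta_M=\mathrm{id}_M$; a morphism $f\colon(M,r)\to(N,s)$ ($T$-linear morphism) satisfies $fr=sT(f)$. $T\text{-}\mathcal{C}$ is the category of $T$-modules. Bimonads: a bimonad on a monoidal category $\mathcal{C}$ is a monad $T$ equipped with natural $T_2(X,Y)\colon T(X\otimes Y)\to T(X)\otimes T(Y)$ and a morphism $T_0\colon T(\mathbf 1)\to\mathbf 1$ making $T$ comonoidal, i.e. $(\mathrm{id}\otimes T_2(Y,Z))T_2(X,Y\otimes Z)=(T_2(X,Y)\otimes \mathrm{id})T_2(X\otimes Y,Z)$ and $(\mathrm{id}\otimes T_0)T_2(X,\mathbf 1)=\mathrm{id}_{T(X)}=(T_0\otimes\mathrm{id})T_2(\mathbf 1,X)$, and such that $\mu,\eta$ are comonoidal: $T_2(X,Y)\mu_{X\otimes Y}=(\mu_X\otimes\mu_Y)T_2(T(X),T(Y))T(T_2(X,Y))$, $T_0\mu_{\mathbf 1}=T_0T(T_0)$, $T_2(X,Y)\eta_{X\otimes Y}=\eta_X\otimes\eta_Y$,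 $T_0\eta_{\mathbf 1}=\mathrm{id}_{\mathbf 1}$. Then $T\text{-}\mathcal{C}$ is monoidal with $(M,r)\otimes(N,s)=(M\otimes N,(r\otimes s)T_2(M,N))$ and unit $(\mathbf 1,T_0)$. Duals: $\mathcal{C}$ is left (resp. right) autonomous if each object $X$ has a left dual $({}^\vee X,\mathrm{ev}_X\colon{}^\vee X\otimes X\to\mathbf 1,\mathrm{coev}_X\colon\mathbf 1\to X\otimes{}^\vee X)$ (resp. a right dual $(X^\vee,\widetilde{\mathrm{ev}}_X\colon X\otimes X^\vee\to\mathbf 1,\widetilde{\mathrm{coev}}_X\colon\mathbf 1\to X^\vee\otimes X)$) satisfying the usual triangle identities; duals are assumed chosen, and ${}^\vee f$, $f^\vee$ denote the dual morphisms. Antipodes: a left antipode for $T$ ($\mathcal{C}$ left autonomous) is a functorial family $s^l_X\colon T({}^\vee T(X))\to{}^\vee X$ such that for all $X$: $T_0T(\mathrm{ev}_X)T({}^\vee\eta_X\otimes\mathrm{id}_X)=\mathrm{ev}_{T(X)}(s^l_{T(X)}T({}^\vee\mu_X)\otimes\mathrm{id}_{T(X)})T_2({}^\vee T(X),X)$ and $(\eta_X\otimes\mathrm{id}_{{}^\vee X})\mathrm{coev}_XT_0=(\mu_X\otimes s^l_X)T_2(T(X),{}^\vee T(X))T(\mathrm{coev}_{T(X)})$. A right antipode for $T$ ($\mathcal{C}$ right autonomous) is a functorial family $s^r_X\colon T(T(X)^\vee)\to X^\vee$ such that for all $X$: $T_0T(\widetilde{\mathrm{ev}}_X)T(\mathrm{id}_X\otimes\eta_X^\vee)=\widetilde{\mathrm{ev}}_{T(X)}(\mathrm{id}_{T(X)}\otimes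 s^r_{T(X)}T(\mu_X^\vee))T_2(X,T(X)^\vee)$ and $(\mathrm{id}_{X^\vee}\otimes\eta_X)\widetilde{\mathrm{coev}}_XT_0=(s^r_X\otimes\mu_X)T_2(T(X)^\vee,T(X))T(\widetilde{\mathrm{coev}}_{T(X)})$. *)

theory Defs
  imports Main
begin

section \<open>Strict monoidal categories\<close>

record ('o, 'a) cat =
  objects :: "'o set" ("Obj\<index>")
  arrows :: "'a set" ("Arr\<index>")
  source :: "'a \<Rightarrow> 'o" ("Dom\<index> _" [1000] 999)
  target :: "'a \<Rightarrow> 'o" ("Cod\<index> _" [1000] 999)
  identity :: "'o \<Rightarrow> 'a" ("Id\<index> _" [1000] 999)
  composite :: "'a \<Rightarrow> 'a \<Rightarrow> 'a" (infixl "\<cdot>\<index>" 70)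

record ('o, 'a) moncat = "('o, 'a) cat" +
  tensor_obj :: "'o \<Rightarrow> 'o \<Rightarrow> 'o" (infixl "\<otimes>\<index>" 75)
  tensor_arr :: "'a \<Rightarrow> 'a \<Rightarrow> 'a" (infixl "\<odot>\<index>" 75)
  unit_obj :: 'o ("\<one>\<index>")

definition hom :: "('o, 'a, 'z) cat_scheme \<Rightarrow> 'o \<Rightarrow> 'o \<Rightarrow> 'a set"
  where "hom C X Y = {f \<in> Arr\<^bsub>C\<^esub>. Dom\<^bsub>C\<^esub> f = X \<and> Cod\<^bsub>C\<^esub> f = Y}"

text \<open>
  Composition is written in the classical order: \<open>g \<cdot> f\<close> is \<open>f\<close> followed by \<open>g\<close>. It is a total
  function in HOL, but only its values on composable pairs are constrained or used; likewise for
  all other operations outside the object and arrow sets.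
\<close>

locale category =
  fixes C :: "('o, 'a, 'z) cat_scheme" (structure)
  assumes Dom_closed: "f \<in> Arr \<Longrightarrow> Dom f \<in> Obj"
    and Cod_closed: "f \<in> Arr \<Longrightarrow> Cod f \<in> Obj"
    and Id_hom: "X \<in> Obj \<Longrightarrow> Id X \<in> hom C X X"
    and Comp_hom: "f \<in> hom C X Y \<Longrightarrow> g \<in> hom C Y Z \<Longrightarrow> g \<cdot> f \<in> hom C X Z"
    and Comp_assoc: "f \<in> hom C W X \<Longrightarrow> g \<in> hom C X Y \<Longrightarrow> h \<in> hom C Y Z \<Longrightarrow>
          h \<cdot> g \<cdot> f = h \<cdot> (g \<cdot> f)"
    and Id_left: "f \<in> hom C X Y \<Longrightarrow> Id Y \<cdot> f = f"
    and Id_right: "f \<in> hom C X Y \<Longrightarrow> f \<cdot> Id X = f"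

locale monoidal_category = category C
  for C :: "('o, 'a, 'z) moncat_scheme" (structure) +
  assumes tensor_obj_closed: "X \<in> Obj \<Longrightarrow> Y \<in> Obj \<Longrightarrow> X \<otimes> Y \<in> Obj"
    and unit_closed: "\<one> \<in> Obj"
    and tensor_hom: "f \<in> hom C X X' \<Longrightarrow> g \<in> hom C Y Y' \<Longrightarrow> f \<odot> g \<in> hom C (X \<otimes> Y) (X' \<otimes> Y')"
    and tensor_Id: "X \<in> Obj \<Longrightarrow> Y \<in> Obj \<Longrightarrow> Id X \<odot> Id Y = Id (X \<otimes> Y)"
    and interchange: "f \<in> hom C X X' \<Longrightarrow> f' \<in> hom C X' X'' \<Longrightarrow>
          g \<in> hom C Y Y' \<Longrightarrow> g' \<in> hom C Y' Y'' \<Longrightarrow>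
          (f' \<cdot> f) \<odot> (g' \<cdot> g) = (f' \<odot> g') \<cdot> (f \<odot> g)"
    and tensor_obj_assoc: "X \<in> Obj \<Longrightarrow> Y \<in> Obj \<Longrightarrow> Z \<in> Obj \<Longrightarrow> X \<otimes> Y \<otimes> Z = X \<otimes> (Y \<otimes> Z)"
    and tensor_arr_assoc: "f \<in> Arr \<Longrightarrow> g \<in> Arr \<Longrightarrow> h \<in> Arr \<Longrightarrow> f \<odot> g \<odot> h = f \<odot> (g \<odot> h)"
    and unit_obj_left: "X \<in> Obj \<Longrightarrow> \<one> \<otimes> X = X"
    and unit_obj_right: "X \<in> Obj \<Longrightarrow> X \<otimes> \<one> = X"
    and unit_arr_left: "f \<in> Arr \<Longrightarrow> Id \<one> \<odot> f = f"
    and unit_arr_right: "f \<in> Arr \<Longrightarrow> f \<odot> Id \<one> = f"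


section \<open>Duals\<close>

text \<open>
  \<open>left_dual C X X' e c\<close>: the object \<open>X'\<close> with evaluation \<open>e\<close> and coevaluation \<open>c\<close> is a left dual
  of \<open>X\<close>.
\<close>

definition left_dual :: "('o, 'a, 'z) moncat_scheme \<Rightarrow> 'o \<Rightarrow> 'o \<Rightarrow> 'a \<Rightarrow> 'a \<Rightarrow> bool" where
  "left_dual C X X' e c \<longleftrightarrow>
     X' \<in> Obj \<and> e \<in> hom C (X' \<otimes> X) \<one> \<and> c \<in> hom C \<one> (X \<otimes> X') \<and>
     (Id X \<odot> e) \<cdot> (c \<odot> Id X) = Id X \<and>
     (e \<odot> Id X') \<cdot> (Id X' \<odot> c) = Id X'" for C (structure)

definition right_dual :: "('o, 'a, 'z) moncat_scheme \<Rightarrow> 'o \<Rightarrow> 'o \<Rightarrow> 'a \<Rightarrow> 'a \<Rightarrow> bool" where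
  "right_dual C X X' e c \<longleftrightarrow>
     X' \<in> Obj \<and> e \<in> hom C (X \<otimes> X') \<one> \<and> c \<in> hom C \<one> (X' \<otimes> X) \<and>
     (e \<odot> Id X) \<cdot> (Id X \<odot> c) = Id X \<and>
     (Id X' \<odot> e) \<cdot> (c \<odot> Id X') = Id X'" for C (structure)

definition left_autonomous :: "('o, 'a, 'z) moncat_scheme \<Rightarrow> bool" where
  "left_autonomous C \<longleftrightarrow> (\<forall>X \<in> Obj\<^bsub>C\<^esub>. \<exists>X' e c. left_dual C X X' e c)"

definition right_autonomous :: "('o, 'a, 'z) moncat_scheme \<Rightarrow> bool" where
  "right_autonomous C \<longleftrightarrow> (\<forall>X \<in> Obj\<^bsub>C\<^esub>. \<exists>X' e c. right_dual C X X' e c)"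

text \<open>A choice of duals for all objects; the same record serves for left and right duals.\<close>

record ('o, 'a) duals =
  dual :: "'o \<Rightarrow> 'o"
  ev :: "'o \<Rightarrow> 'a"
  coev :: "'o \<Rightarrow> 'a"

definition left_duals :: "('o, 'a, 'z) moncat_scheme \<Rightarrow> ('o, 'a, 'd) duals_scheme \<Rightarrow> bool" where
  "left_duals C D \<longleftrightarrow> (\<forall>X \<in> Obj\<^bsub>C\<^esub>. left_dual C X (dual D X) (ev D X) (coev D X))"

definition right_duals :: "('o, 'a, 'z) moncat_scheme \<Rightarrow> ('o, 'a, 'd) duals_scheme \<Rightarrow> bool" where
  "right_duals C D \<longleftrightarrow> (\<forall>X \<in> Obj\<^bsub>C\<^esub>. right_dual C X (dual D X) (ev D X) (coev D X))"

lemma left_autonomous_iff_duals: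
  "left_autonomous C \<longleftrightarrow> (\<exists>D :: ('o, 'a) duals. left_duals C D)"
  for C :: "('o, 'a, 'z) moncat_scheme"
proof
  assume "left_autonomous C"
  then obtain d e c where "\<forall>X \<in> Obj\<^bsub>C\<^esub>. left_dual C X (d X) (e X) (c X)"
    unfolding left_autonomous_def by metis
  then have "left_duals C \<lparr>dual = d, ev = e, coev = c\<rparr>"
    by (simp add: left_duals_def)
  then show "\<exists>D :: ('o, 'a) duals. left_duals C D" ..
qed (auto simp: left_autonomous_def left_duals_def)

lemma right_autonomous_iff_duals:
  "right_autonomous C \<longleftrightarrow> (\<exists>D :: ('o, 'a) duals. right_duals C D)"
  for C :: "('o, 'a, 'z) moncat_scheme"
proof
  assume "right_autonomous C"
  then obtain d e c where "\<forall>X \<in> Obj\<^bsub>C\<^esub>. right_dual C X (d X) (e X) (c X)"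
    unfolding right_autonomous_def by metis
  then have "right_duals C \<lparr>dual = d, ev = e, coev = c\<rparr>"
    by (simp add: right_duals_def)
  then show "\<exists>D :: ('o, 'a) duals. right_duals C D" ..
qed (auto simp: right_autonomous_def right_duals_def)

text \<open>
  The dual morphisms \<open>dual D Y \<rightarrow> dual D X\<close> of \<open>f : X \<rightarrow> Y\<close>; strictness removes all associativity
  and unit constraints.
\<close>

definition left_dual_arr ::
  "('o, 'a, 'z) moncat_scheme \<Rightarrow> ('o, 'a, 'd) duals_scheme \<Rightarrow> 'a \<Rightarrow> 'a" where
  "left_dual_arr C D f =
     (ev D (Cod f) \<odot> Id (dual D (Dom f))) \<cdot>
     (Id (dual D (Cod f)) \<odot> f \<odot> Id (dual D (Dom f))) \<cdot>
     (Id (dual D (Cod f)) \<odot> coev D (Dom f))" for C (structure)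

definition right_dual_arr ::
  "('o, 'a, 'z) moncat_scheme \<Rightarrow> ('o, 'a, 'd) duals_scheme \<Rightarrow> 'a \<Rightarrow> 'a" where
  "right_dual_arr C D f =
     (Id (dual D (Dom f)) \<odot> ev D (Cod f)) \<cdot>
     (Id (dual D (Dom f)) \<odot> f \<odot> Id (dual D (Cod f))) \<cdot>
     (coev D (Dom f) \<odot> Id (dual D (Cod f)))" for C (structure)


section \<open>Monads and bimonads\<close>

text \<open>\<open>fob\<close> and \<open>far\<close> are the actions of the underlying endofunctor on objects and on arrows.\<close>

record ('o, 'a) monad_data =
  fob :: "'o \<Rightarrow> 'o"
  far :: "'a \<Rightarrow> 'a"
  mu :: "'o \<Rightarrow> 'a"
  eta :: "'o \<Rightarrow> 'a"

record ('o, 'a) bimonad_data = "('o, 'a) monad_data" +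
  T2 :: "'o \<Rightarrow> 'o \<Rightarrow> 'a"
  T0 :: 'a

locale monad = category C
  for C :: "('o, 'a, 'z) cat_scheme" (structure) and T :: "('o, 'a, 't) monad_data_scheme" +
  assumes fob_closed: "X \<in> Obj \<Longrightarrow> fob T X \<in> Obj"
    and far_hom: "f \<in> hom C X Y \<Longrightarrow> far T f \<in> hom C (fob T X) (fob T Y)"
    and far_Id: "X \<in> Obj \<Longrightarrow> far T (Id X) = Id (fob T X)"
    and far_Comp: "f \<in> hom C X Y \<Longrightarrow> g \<in> hom C Y Z \<Longrightarrow> far T (g \<cdot> f) = far T g \<cdot> far T f"
    and mu_hom: "X \<in> Obj \<Longrightarrow> mu T X \<in> hom C (fob T (fob T X)) (fob T X)"
    and mu_natural: "f \<in> hom C X Y \<Longrightarrow> mu T Y \<cdot> far T (far T f) = far T f \<cdot> mu T X"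
    and eta_hom: "X \<in> Obj \<Longrightarrow> eta T X \<in> hom C X (fob T X)"
    and eta_natural: "f \<in> hom C X Y \<Longrightarrow> eta T Y \<cdot> f = far T f \<cdot> eta T X"
    and mu_assoc: "X \<in> Obj \<Longrightarrow> mu T X \<cdot> far T (mu T X) = mu T X \<cdot> mu T (fob T X)"
    and mu_eta: "X \<in> Obj \<Longrightarrow> mu T X \<cdot> eta T (fob T X) = Id (fob T X)"
    and mu_far_eta: "X \<in> Obj \<Longrightarrow> mu T X \<cdot> far T (eta T X) = Id (fob T X)"

locale bimonad = monoidal_category C + monad C T
  for C :: "('o, 'a, 'z) moncat_scheme" (structure) and T :: "('o, 'a, 't) bimonad_data_scheme" +
  assumes T2_hom: "X \<in> Obj \<Longrightarrow> Y \<in> Obj \<Longrightarrow>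
          T2 T X Y \<in> hom C (fob T (X \<otimes> Y)) (fob T X \<otimes> fob T Y)"
    and T2_natural: "f \<in> hom C X X' \<Longrightarrow> g \<in> hom C Y Y' \<Longrightarrow>
          T2 T X' Y' \<cdot> far T (f \<odot> g) = (far T f \<odot> far T g) \<cdot> T2 T X Y"
    and T0_hom: "T0 T \<in> hom C (fob T \<one>) \<one>"
    and T2_coassoc: "X \<in> Obj \<Longrightarrow> Y \<in> Obj \<Longrightarrow> Z \<in> Obj \<Longrightarrow>
          (Id (fob T X) \<odot> T2 T Y Z) \<cdot> T2 T X (Y \<otimes> Z) =
          (T2 T X Y \<odot> Id (fob T Z)) \<cdot> T2 T (X \<otimes> Y) Z"
    and T2_counit_right: "X \<in> Obj \<Longrightarrow> (Id (fob T X) \<odot> T0 T) \<cdot> T2 T X \<one> = Id (fob T X)"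
    and T2_counit_left: "X \<in> Obj \<Longrightarrow> (T0 T \<odot> Id (fob T X)) \<cdot> T2 T \<one> X = Id (fob T X)"
    and T2_mu: "X \<in> Obj \<Longrightarrow> Y \<in> Obj \<Longrightarrow>
          T2 T X Y \<cdot> mu T (X \<otimes> Y) =
          (mu T X \<odot> mu T Y) \<cdot> T2 T (fob T X) (fob T Y) \<cdot> far T (T2 T X Y)"
    and T0_mu: "T0 T \<cdot> mu T \<one> = T0 T \<cdot> far T (T0 T)"
    and T2_eta: "X \<in> Obj \<Longrightarrow> Y \<in> Obj \<Longrightarrow> T2 T X Y \<cdot> eta T (X \<otimes> Y) = eta T X \<odot> eta T Y"
    and T0_eta: "T0 T \<cdot> eta T \<one> = Id \<one>"


section \<open>The monoidal category of modules over a bimonad\<close>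

definition is_module ::
  "('o, 'a, 'z) cat_scheme \<Rightarrow> ('o, 'a, 't) monad_data_scheme \<Rightarrow> 'o \<times> 'a \<Rightarrow> bool" where
  "is_module C T = (\<lambda>(M, r). M \<in> Obj \<and> r \<in> hom C (fob T M) M \<and>
     r \<cdot> far T r = r \<cdot> mu T M \<and> r \<cdot> eta T M = Id M)" for C (structure)

definition tensor_module ::
  "('o, 'a, 'z) moncat_scheme \<Rightarrow> ('o, 'a, 't) bimonad_data_scheme \<Rightarrow>
   'o \<times> 'a \<Rightarrow> 'o \<times> 'a \<Rightarrow> 'o \<times> 'a" where
  "tensor_module C T = (\<lambda>(M, r) (N, s). (M \<otimes> N, (r \<odot> s) \<cdot> T2 T M N))" for C (structure)

text \<open>
  One underlying morphism of \<open>C\<close> may be linear for several module structures, so an arrow of the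
  category of modules is a triple consisting of source, underlying morphism and target.
\<close>

definition modules ::
  "('o, 'a, 'z) moncat_scheme \<Rightarrow> ('o, 'a, 't) bimonad_data_scheme \<Rightarrow>
   ('o \<times> 'a, ('o \<times> 'a) \<times> 'a \<times> ('o \<times> 'a)) moncat" where
  "modules C T =
     \<lparr>objects = {P. is_module C T P},
      arrows = {((M, r), f, (N, s)) | M r f N s. is_module C T (M, r) \<and> is_module C T (N, s) \<and>
                  f \<in> hom C M N \<and> f \<cdot> r = s \<cdot> far T f},
      source = (\<lambda>(P, f, Q). P),
      target = (\<lambda>(P, f, Q). Q),
      identity = (\<lambda>(M, r). ((M, r), Id M, (M, r))),
      composite = (\<lambda>(Q, g, R) (P, f, Q'). (P, g \<cdot> f, R)),
      tensor_obj = tensor_module C T,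
      tensor_arr = (\<lambda>(P, f, Q) (P', f', Q').
                      (tensor_module C T P P', f \<odot> f', tensor_module C T Q Q')),
      unit_obj = (\<one>, T0 T)\<rparr>" for C (structure)

text \<open>
  The modules form a strict monoidal category, so the notions of duals and autonomy apply to it.
\<close>

context bimonad
begin

lemma hom_arr: "f \<in> hom C X Y \<Longrightarrow> f \<in> Arr" by (simp add: hom_def)

lemma unit_module: "is_module C T (\<one>, T0 T)"
  by (simp add: is_module_def unit_closed T0_hom T0_mu T0_eta)

lemma tensor_module_closed:
  assumes "is_module C T (M, r)" "is_module C T (N, s)"
  shows "is_module C T (M \<otimes> N, (r \<odot> s) \<cdot> T2 T M N)"
proof -
  have M: "M \<in> Obj" "r \<in> hom C (fob T M) M" "r \<cdot> far T r = r \<cdot> mu T M" "r \<cdot> eta T M = Id M"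
   and N: "N \<in> Obj" "s \<in> hom C (fob T N) N" "s \<cdot> far T s = s \<cdot> mu T N" "s \<cdot> eta T N = Id N"
    using assms by (auto simp: is_module_def)
  have MN: "M \<otimes> N \<in> Obj" using M N tensor_obj_closed by auto
  have t: "T2 T M N \<in> hom C (fob T (M \<otimes> N)) (fob T M \<otimes> fob T N)" using M N T2_hom by auto
  have rs: "r \<odot> s \<in> hom C (fob T M \<otimes> fob T N) (M \<otimes> N)" using M N tensor_hom by auto
  have h: "(r \<odot> s) \<cdot> T2 T M N \<in> hom C (fob T (M \<otimes> N)) (M \<otimes> N)" using rs t Comp_hom by blast
  have Trs: "far T (r \<odot> s) \<in> hom C (fob T (fob T M \<otimes> fob T N)) (fob T (M \<otimes> N))" using rs far_hom by auto
  have Tt: "far T (T2 T M N) \<in> hom C (fob T (fob T (M \<otimes> N))) (fob T (fob T M \<otimes> fob T N))" using t far_hom by auto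
  have t': "T2 T (fob T M) (fob T N) \<in> hom C (fob T (fob T M \<otimes> fob T N)) (fob T (fob T M) \<otimes> fob T (fob T N))"
    using M N T2_hom fob_closed by auto
  have TrTs: "far T r \<odot> far T s \<in> hom C (fob T (fob T M) \<otimes> fob T (fob T N)) (fob T M \<otimes> fob T N)"
    using M N tensor_hom far_hom by auto
  have mm: "mu T M \<odot> mu T N \<in> hom C (fob T (fob T M) \<otimes> fob T (fob T N)) (fob T M \<otimes> fob T N)"
    using M N tensor_hom mu_hom by auto
  have e: "eta T (M \<otimes> N) \<in> hom C (M \<otimes> N) (fob T (M \<otimes> N))" using MN eta_hom by auto
  have mu: "mu T (M \<otimes> N) \<in> hom C (fob T (fob T (M \<otimes> N))) (fob T (M \<otimes> N))" using MN mu_hom by auto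
  have "(r \<odot> s) \<cdot> T2 T M N \<cdot> far T ((r \<odot> s) \<cdot> T2 T M N)
      = (r \<odot> s) \<cdot> (T2 T M N \<cdot> (far T (r \<odot> s) \<cdot> far T (T2 T M N)))"
    using far_Comp[OF t rs] Comp_assoc[OF Comp_hom[OF Tt Trs] t rs] by simp
  also have "\<dots> = (r \<odot> s) \<cdot> ((T2 T M N \<cdot> far T (r \<odot> s)) \<cdot> far T (T2 T M N))"
    using Comp_assoc[OF Tt Trs t] by simp
  also have "\<dots> = (r \<odot> s) \<cdot> (((far T r \<odot> far T s) \<cdot> T2 T (fob T M) (fob T N)) \<cdot> far T (T2 T M N))"
    using T2_natural M N by simp
  also have "\<dots> = ((r \<odot> s) \<cdot> (far T r \<odot> far T s)) \<cdot> (T2 T (fob T M) (fob T N) \<cdot> far T (T2 T M N))"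
    using Comp_assoc[OF Tt t' TrTs] Comp_assoc[OF Comp_hom[OF Tt t'] TrTs rs] by simp
  also have "(r \<odot> s) \<cdot> (far T r \<odot> far T s) = (r \<odot> s) \<cdot> (mu T M \<odot> mu T N)"
    using interchange[OF far_hom[OF M(2)] M(2) far_hom[OF N(2)] N(2)]
       interchange[OF mu_hom[OF M(1)] M(2) mu_hom[OF N(1)] N(2)] M N by simp
  also have "\<dots> \<cdot> (T2 T (fob T M) (fob T N) \<cdot> far T (T2 T M N)) =
      (r \<odot> s) \<cdot> ((mu T M \<odot> mu T N) \<cdot> T2 T (fob T M) (fob T N) \<cdot> far T (T2 T M N))"
    using Comp_assoc[OF Tt t' mm] Comp_assoc[OF Comp_hom[OF Tt t'] mm rs] by simp
  also have "\<dots> = (r \<odot> s) \<cdot> (T2 T M N \<cdot> mu T (M \<otimes> N))" using T2_mu M N by simp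
  also have "\<dots> = (r \<odot> s) \<cdot> T2 T M N \<cdot> mu T (M \<otimes> N)" using Comp_assoc[OF mu t rs] by simp
  finally have 1: "(r \<odot> s) \<cdot> T2 T M N \<cdot> far T ((r \<odot> s) \<cdot> T2 T M N) = (r \<odot> s) \<cdot> T2 T M N \<cdot> mu T (M \<otimes> N)" .
  have 2: "(r \<odot> s) \<cdot> T2 T M N \<cdot> eta T (M \<otimes> N) = Id (M \<otimes> N)"
    using Comp_assoc[OF e t rs] T2_eta[OF M(1) N(1)] interchange[OF eta_hom[OF M(1)] M(2) eta_hom[OF N(1)] N(2)]
     M N tensor_Id by simp
  show ?thesis using MN h 1 2 by (simp add: is_module_def)
qed

lemma tensor_linear:
  assumes "is_module C T (M, r)" "is_module C T (N, s)" "is_module C T (M', r')" "is_module C T (N', s')"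
   "f \<in> hom C M M'" "g \<in> hom C N N'" "f \<cdot> r = r' \<cdot> far T f" "g \<cdot> s = s' \<cdot> far T g"
  shows "(f \<odot> g) \<cdot> ((r \<odot> s) \<cdot> T2 T M N) = (r' \<odot> s') \<cdot> T2 T M' N' \<cdot> far T (f \<odot> g)"
proof -
  have M: "M \<in> Obj" "r \<in> hom C (fob T M) M" and N: "N \<in> Obj" "s \<in> hom C (fob T N) N"
   and M': "M' \<in> Obj" "r' \<in> hom C (fob T M') M'" and N': "N' \<in> Obj" "s' \<in> hom C (fob T N') N'"
    using assms by (auto simp: is_module_def)
  note t = T2_hom[OF M(1) N(1)] and t' = T2_hom[OF M'(1) N'(1)]
  have fg: "f \<odot> g \<in> hom C (M \<otimes> N) (M' \<otimes> N')" using assms tensor_hom by auto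
  have rs: "r \<odot> s \<in> hom C (fob T M \<otimes> fob T N) (M \<otimes> N)" using M N tensor_hom by auto
  have rs': "r' \<odot> s' \<in> hom C (fob T M' \<otimes> fob T N') (M' \<otimes> N')" using M' N' tensor_hom by auto
  have TT: "far T f \<odot> far T g \<in> hom C (fob T M \<otimes> fob T N) (fob T M' \<otimes> fob T N')"
    using assms far_hom tensor_hom by auto
  have "(f \<odot> g) \<cdot> (r \<odot> s) = (r' \<odot> s') \<cdot> (far T f \<odot> far T g)"
    using interchange[OF M(2) assms(5) N(2) assms(6)]
     interchange[OF far_hom[OF assms(5)] M'(2) far_hom[OF assms(6)] N'(2)] assms by simp
  then show ?thesis
    using Comp_assoc[OF t rs fg] Comp_assoc[OF t TT rs'] Comp_assoc[OF far_hom[OF fg] t' rs']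
      T2_natural[OF assms(5,6)] by simp
qed

lemma tensor_module_assoc:
  assumes "is_module C T (M, r)" "is_module C T (N, s)" "is_module C T (P, t)"
  shows "(((r \<odot> s) \<cdot> T2 T M N) \<odot> t) \<cdot> T2 T (M \<otimes> N) P = (r \<odot> ((s \<odot> t) \<cdot> T2 T N P)) \<cdot> T2 T M (N \<otimes> P)"
proof -
  have M: "M \<in> Obj" "r \<in> hom C (fob T M) M" and N: "N \<in> Obj" "s \<in> hom C (fob T N) N"
   and P: "P \<in> Obj" "t \<in> hom C (fob T P) P"
    using assms by (auto simp: is_module_def)
  note a = T2_hom[OF M(1) N(1)] and b = T2_hom[OF N(1) P(1)]
  note a2 = T2_hom[OF tensor_obj_closed[OF M(1) N(1)] P(1)]
  note b2 = T2_hom[OF M(1) tensor_obj_closed[OF N(1) P(1)]]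
  note rs = tensor_hom[OF M(2) N(2)] and st = tensor_hom[OF N(2) P(2)]
  note iP = Id_hom[OF fob_closed[OF P(1)]] and iM = Id_hom[OF fob_closed[OF M(1)]]
  have L: "((r \<odot> s) \<cdot> T2 T M N) \<odot> t = (r \<odot> s \<odot> t) \<cdot> (T2 T M N \<odot> Id (fob T P))"
    using interchange[OF a rs iP P(2)] Id_right[OF P(2)] by simp
  have R: "r \<odot> ((s \<odot> t) \<cdot> T2 T N P) = (r \<odot> (s \<odot> t)) \<cdot> (Id (fob T M) \<odot> T2 T N P)"
    using interchange[OF iM M(2) b st] Id_right[OF M(2)] by simp
  show ?thesis unfolding L R
    using Comp_assoc[OF a2 tensor_hom[OF a iP] tensor_hom[OF rs P(2)]]
     Comp_assoc[OF b2 tensor_hom[OF iM b] tensor_hom[OF M(2) st]]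
     T2_coassoc[OF M(1) N(1) P(1)] tensor_arr_assoc M N P hom_arr by auto
qed

lemma tensor_module_unit:
  assumes "is_module C T (M, r)"
  shows "(T0 T \<odot> r) \<cdot> T2 T \<one> M = r" "(r \<odot> T0 T) \<cdot> T2 T M \<one> = r"
proof -
  have M: "M \<in> Obj" "r \<in> hom C (fob T M) M" using assms by (auto simp: is_module_def)
  note i = Id_hom[OF fob_closed[OF M(1)]] and i1 = Id_hom[OF unit_closed]
  note a = T2_hom[OF unit_closed M(1)] and b = T2_hom[OF M(1) unit_closed]
  have "T0 T \<odot> r = (Id \<one> \<odot> r) \<cdot> (T0 T \<odot> Id (fob T M))"
    using interchange[OF T0_hom i1 i M(2)] Id_left[OF T0_hom] Id_right[OF M(2)] by simp
  then show "(T0 T \<odot> r) \<cdot> T2 T \<one> M = r"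
    using Comp_assoc[OF a tensor_hom[OF T0_hom i] tensor_hom[OF i1 M(2)]] T2_counit_left[OF M(1)]
      unit_arr_left[OF hom_arr[OF M(2)]] Id_right[OF M(2)] by simp
  have "r \<odot> T0 T = (r \<odot> Id \<one>) \<cdot> (Id (fob T M) \<odot> T0 T)"
    using interchange[OF i M(2) T0_hom i1] Id_left[OF T0_hom] Id_right[OF M(2)] by simp
  then show "(r \<odot> T0 T) \<cdot> T2 T M \<one> = r"
    using Comp_assoc[OF b tensor_hom[OF i T0_hom] tensor_hom[OF M(2) i1]] T2_counit_right[OF M(1)]
      unit_arr_right[OF hom_arr[OF M(2)]] Id_right[OF M(2)] by simp
qed

lemma moduleD: assumes "is_module C T (M, r)" shows "M \<in> Obj" "r \<in> hom C (fob T M) M"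
  using assms by (auto simp: is_module_def)

lemma hom_mod:
  "x \<in> hom (modules C T) P Q \<longleftrightarrow> (\<exists>M r f N s. P = (M, r) \<and> Q = (N, s) \<and> x = (P, f, Q) \<and>
     is_module C T (M, r) \<and> is_module C T (N, s) \<and> f \<in> hom C M N \<and> f \<cdot> r = s \<cdot> far T f)"
  by (auto simp: hom_def modules_def)

lemma arr_mod:
  "x \<in> arrows (modules C T) \<longleftrightarrow> (\<exists>M r f N s. x = ((M,r), f, (N,s)) \<and>
     is_module C T (M, r) \<and> is_module C T (N, s) \<and> f \<in> hom C M N \<and> f \<cdot> r = s \<cdot> far T f)"
  by (auto simp: modules_def)

lemma mod_sel:
  "objects (modules C T) = {P. is_module C T P}"
  "source (modules C T) (P, f, Q) = P" "target (modules C T) (P, f, Q) = Q"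
  "identity (modules C T) (M, r) = ((M, r), Id M, (M, r))"
  "composite (modules C T) (Q, g, R) (P, f, Q') = (P, g \<cdot> f, R)"
  "tensor_obj (modules C T) = tensor_module C T"
  "tensor_arr (modules C T) (P, f, Q) (P', f', Q') = (tensor_module C T P P', f \<odot> f', tensor_module C T Q Q')"
  "unit_obj (modules C T) = (\<one>, T0 T)"
  by (simp_all add: modules_def)

lemma comp_linear:
  assumes "is_module C T (M, r)" "is_module C T (N, s)" "is_module C T (P, t)"
    "f \<in> hom C M N" "f \<cdot> r = s \<cdot> far T f" "g \<in> hom C N P" "g \<cdot> s = t \<cdot> far T g"
  shows "g \<cdot> f \<cdot> r = t \<cdot> far T (g \<cdot> f)"
  using Comp_assoc[OF moduleD(2)[OF assms(1)] assms(4,6)]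
    Comp_assoc[OF far_hom[OF assms(4)] moduleD(2)[OF assms(2)] assms(6)]
    Comp_assoc[OF far_hom[OF assms(4)] far_hom[OF assms(6)] moduleD(2)[OF assms(3)]]
    far_Comp[OF assms(4,6)] assms(5,7) by simp

lemma id_linear:
  assumes "is_module C T (M, r)"
  shows "Id M \<cdot> r = r \<cdot> far T (Id M)"
  using moduleD[OF assms] by (simp add: Id_left Id_right far_Id)

theorem modules_monoidal: "monoidal_category (modules C T)"
proof unfold_locales
  fix f show "f \<in> Arr\<^bsub>modules C T\<^esub> \<Longrightarrow> Dom\<^bsub>modules C T\<^esub> f \<in> Obj\<^bsub>modules C T\<^esub>"
    by (auto simp: arr_mod mod_sel)
next
  fix f show "f \<in> Arr\<^bsub>modules C T\<^esub> \<Longrightarrow> Cod\<^bsub>modules C T\<^esub> f \<in> Obj\<^bsub>modules C T\<^esub>"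
    by (auto simp: arr_mod mod_sel)
next
  fix X show "X \<in> Obj\<^bsub>modules C T\<^esub> \<Longrightarrow> Id\<^bsub>modules C T\<^esub> X \<in> hom (modules C T) X X"
    by (cases X) (auto simp: hom_mod mod_sel id_linear Id_hom moduleD)
next
  fix f g X Y Z assume "f \<in> hom (modules C T) X Y" "g \<in> hom (modules C T) Y Z"
  then show "g \<cdot>\<^bsub>modules C T\<^esub> f \<in> hom (modules C T) X Z"
    by (auto simp: hom_mod mod_sel comp_linear intro: Comp_hom)
next
  fix f g h X Y Z W assume "f \<in> hom (modules C T) W X" "g \<in> hom (modules C T) X Y" "h \<in> hom (modules C T) Y Z"
  then show "h \<cdot>\<^bsub>modules C T\<^esub> g \<cdot>\<^bsub>modules C T\<^esub> f = h \<cdot>\<^bsub>modules C T\<^esub> (g \<cdot>\<^bsub>modules C T\<^esub> f)"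
    by (auto simp: hom_mod mod_sel intro: Comp_assoc)
next
  fix f X Y assume "f \<in> hom (modules C T) X Y"
  then show "Id\<^bsub>modules C T\<^esub> Y \<cdot>\<^bsub>modules C T\<^esub> f = f" "f \<cdot>\<^bsub>modules C T\<^esub> Id\<^bsub>modules C T\<^esub> X = f"
    by (auto simp: hom_mod mod_sel intro: Id_left Id_right)
next
  fix X Y assume "X \<in> Obj\<^bsub>modules C T\<^esub>" "Y \<in> Obj\<^bsub>modules C T\<^esub>"
  then show "X \<otimes>\<^bsub>modules C T\<^esub> Y \<in> Obj\<^bsub>modules C T\<^esub>"
    and "Id\<^bsub>modules C T\<^esub> X \<odot>\<^bsub>modules C T\<^esub> Id\<^bsub>modules C T\<^esub> Y = Id\<^bsub>modules C T\<^esub> (X \<otimes>\<^bsub>modules C T\<^esub> Y)"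
    by (cases X; cases Y; auto simp: mod_sel tensor_module_def tensor_module_closed tensor_Id moduleD)+
next
  show "\<one>\<^bsub>modules C T\<^esub> \<in> Obj\<^bsub>modules C T\<^esub>" by (simp add: mod_sel unit_module)
next
  fix f X X' g Y Y' assume "f \<in> hom (modules C T) X X'" "g \<in> hom (modules C T) Y Y'"
  then show "f \<odot>\<^bsub>modules C T\<^esub> g \<in> hom (modules C T) (X \<otimes>\<^bsub>modules C T\<^esub> Y) (X' \<otimes>\<^bsub>modules C T\<^esub> Y')"
    by (auto simp: hom_mod mod_sel tensor_module_def tensor_module_closed tensor_hom intro: tensor_linear)
next
  fix f X X' f' X'' g Y Y' g' Y''
  assume "f \<in> hom (modules C T) X X'" "f' \<in> hom (modules C T) X' X''"
    "g \<in> hom (modules C T) Y Y'" "g' \<in> hom (modules C T) Y' Y''"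
  then show "(f' \<cdot>\<^bsub>modules C T\<^esub> f) \<odot>\<^bsub>modules C T\<^esub> (g' \<cdot>\<^bsub>modules C T\<^esub> g) =
    (f' \<odot>\<^bsub>modules C T\<^esub> g') \<cdot>\<^bsub>modules C T\<^esub> (f \<odot>\<^bsub>modules C T\<^esub> g)"
    by (auto simp: hom_mod mod_sel intro: interchange)
next
  fix X Y Z assume "X \<in> Obj\<^bsub>modules C T\<^esub>" "Y \<in> Obj\<^bsub>modules C T\<^esub>" "Z \<in> Obj\<^bsub>modules C T\<^esub>"
  then show "X \<otimes>\<^bsub>modules C T\<^esub> Y \<otimes>\<^bsub>modules C T\<^esub> Z = X \<otimes>\<^bsub>modules C T\<^esub> (Y \<otimes>\<^bsub>modules C T\<^esub> Z)"
    by (cases X; cases Y; cases Z; auto simp: mod_sel tensor_module_def tensor_module_assoc tensor_obj_assoc moduleD)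
next
  fix f g h assume "f \<in> Arr\<^bsub>modules C T\<^esub>" "g \<in> Arr\<^bsub>modules C T\<^esub>" "h \<in> Arr\<^bsub>modules C T\<^esub>"
  then show "f \<odot>\<^bsub>modules C T\<^esub> g \<odot>\<^bsub>modules C T\<^esub> h = f \<odot>\<^bsub>modules C T\<^esub> (g \<odot>\<^bsub>modules C T\<^esub> h)"
    by (auto simp: arr_mod mod_sel tensor_module_def tensor_module_assoc tensor_obj_assoc tensor_arr_assoc moduleD hom_arr)
next
  fix X assume "X \<in> Obj\<^bsub>modules C T\<^esub>"
  then show "\<one>\<^bsub>modules C T\<^esub> \<otimes>\<^bsub>modules C T\<^esub> X = X" "X \<otimes>\<^bsub>modules C T\<^esub> \<one>\<^bsub>modules C T\<^esub> = X"
    by (cases X; auto simp: mod_sel tensor_module_def tensor_module_unit unit_obj_left unit_obj_right moduleD)+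
next
  fix f assume "f \<in> Arr\<^bsub>modules C T\<^esub>"
  then show "Id\<^bsub>modules C T\<^esub> \<one>\<^bsub>modules C T\<^esub> \<odot>\<^bsub>modules C T\<^esub> f = f" "f \<odot>\<^bsub>modules C T\<^esub> Id\<^bsub>modules C T\<^esub> \<one>\<^bsub>modules C T\<^esub> = f"
    by (auto simp: arr_mod mod_sel tensor_module_def tensor_module_unit unit_obj_left unit_obj_right unit_arr_left unit_arr_right moduleD hom_arr)
qed

end


section \<open>Antipodes\<close>

text \<open>
  The conditions \<open>antipode_natural\<close> express the naturality of \<open>s\<close> as a transformation between the
  contravariant endofunctors \<open>X \<mapsto> fob T (dual D (fob T X))\<close> and \<open>X \<mapsto> dual D X\<close> of \<open>C\<close>.
\<close>

locale left_antipode = bimonad C T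
  for C :: "('o, 'a, 'z) moncat_scheme" (structure) and T :: "('o, 'a, 't) bimonad_data_scheme"
    and D :: "('o, 'a, 'd) duals_scheme" and s :: "'o \<Rightarrow> 'a" +
  assumes duals: "left_duals C D"
    and antipode_hom: "X \<in> Obj \<Longrightarrow> s X \<in> hom C (fob T (dual D (fob T X))) (dual D X)"
    and antipode_natural: "f \<in> hom C X Y \<Longrightarrow>
          s X \<cdot> far T (left_dual_arr C D (far T f)) = left_dual_arr C D f \<cdot> s Y"
    and antipode_ev: "X \<in> Obj \<Longrightarrow>
          T0 T \<cdot> far T (ev D X) \<cdot> far T (left_dual_arr C D (eta T X) \<odot> Id X) =
          ev D (fob T X) \<cdot>
          ((s (fob T X) \<cdot> far T (left_dual_arr C D (mu T X))) \<odot> Id (fob T X)) \<cdot>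
          T2 T (dual D (fob T X)) X"
    and antipode_coev: "X \<in> Obj \<Longrightarrow>
          (eta T X \<odot> Id (dual D X)) \<cdot> coev D X \<cdot> T0 T =
          (mu T X \<odot> s X) \<cdot> T2 T (fob T X) (dual D (fob T X)) \<cdot> far T (coev D (fob T X))"

locale right_antipode = bimonad C T
  for C :: "('o, 'a, 'z) moncat_scheme" (structure) and T :: "('o, 'a, 't) bimonad_data_scheme"
    and D :: "('o, 'a, 'd) duals_scheme" and s :: "'o \<Rightarrow> 'a" +
  assumes duals: "right_duals C D"
    and antipode_hom: "X \<in> Obj \<Longrightarrow> s X \<in> hom C (fob T (dual D (fob T X))) (dual D X)"
    and antipode_natural: "f \<in> hom C X Y \<Longrightarrow>
          s X \<cdot> far T (right_dual_arr C D (far T f)) = right_dual_arr C D f \<cdot> s Y"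
    and antipode_ev: "X \<in> Obj \<Longrightarrow>
          T0 T \<cdot> far T (ev D X) \<cdot> far T (Id X \<odot> right_dual_arr C D (eta T X)) =
          ev D (fob T X) \<cdot>
          (Id (fob T X) \<odot> (s (fob T X) \<cdot> far T (right_dual_arr C D (mu T X)))) \<cdot>
          T2 T X (dual D (fob T X))"
    and antipode_coev: "X \<in> Obj \<Longrightarrow>
          (Id (dual D X) \<odot> eta T X) \<cdot> coev D X \<cdot> T0 T =
          (s X \<odot> mu T X) \<cdot> T2 T (dual D (fob T X)) (fob T X) \<cdot> far T (coev D (fob T X))"

end

theory Submission
  imports Defs
begin

text \<open>
  For a module \<open>(M, r)\<close> call \<open>r' : T(\<^sup>\<or>M) \<rightarrow> \<^sup>\<or>M\<close> a dual structure if it makes \<open>ev\<close> and \<open>coev\<close>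
  linear. As for inverses in a convolution monoid, an arrow \<open>g : T(A) \<rightarrow> \<^sup>\<or>M\<close> is determined by
  \<open>ev (g \<otimes> r) T2\<close> as soon as \<open>r'\<close> satisfies the condition on \<open>coev\<close>. This cancellation makes \<open>r'\<close>
  unique and natural in \<open>(M, r)\<close>; applied to the comonoidal functors \<open>T \<circ> T\<close> and \<open>id\<close> instead of \<open>T\<close>
  it also makes \<open>r'\<close> an action. An antipode \<open>s\<close> yields the dual structures \<open>s\<^sub>M T(\<^sup>\<or>r)\<close>. Conversely
  duals of modules give dual structures \<open>a\<^sub>X\<close> on the free modules \<open>(T X, \<mu>\<^sub>X)\<close>, and \<open>\<^sup>\<or>\<eta>\<^sub>X a\<^sub>X\<close> is an
  antipode; every antipode arises in this way, whence uniqueness. The statement for right duals is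
  the one for left duals in the category with reversed tensor product.
\<close>

section \<open>Calculating in strict monoidal categories\<close>

lemma mem_hom: "f \<in> hom C X Y \<longleftrightarrow> f \<in> Arr \<and> Dom f = X \<and> Cod f = Y" for C (structure)
  by (simp add: hom_def)

context category
begin

lemma cat_arr [simp]:
  "f \<in> Arr \<Longrightarrow> Dom f \<in> Obj" "f \<in> Arr \<Longrightarrow> Cod f \<in> Obj"
  "X \<in> Obj \<Longrightarrow> Id X \<in> Arr" "X \<in> Obj \<Longrightarrow> Dom (Id X) = X" "X \<in> Obj \<Longrightarrow> Cod (Id X) = X"
  using Dom_closed Cod_closed Id_hom by (auto simp: mem_hom)

lemma comp_arr [simp]:
  assumes "f \<in> Arr" "g \<in> Arr" "Cod f = Dom g"
  shows "g \<cdot> f \<in> Arr" "Dom (g \<cdot> f) = Dom f" "Cod (g \<cdot> f) = Cod g"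
  using Comp_hom[of f "Dom f" "Cod f" g "Cod g"] assms by (auto simp: mem_hom)

lemma comp_assoc [simp]:
  assumes "f \<in> Arr" "g \<in> Arr" "h \<in> Arr" "Cod f = Dom g" "Cod g = Dom h"
  shows "h \<cdot> g \<cdot> f = h \<cdot> (g \<cdot> f)"
  using Comp_assoc[of f "Dom f" "Cod f" g "Cod g" h "Cod h"] assms by (auto simp: mem_hom)

lemma comp_Id [simp]:
  "f \<in> Arr \<Longrightarrow> Cod f = X \<Longrightarrow> Id X \<cdot> f = f"
  "f \<in> Arr \<Longrightarrow> Dom f = X \<Longrightarrow> f \<cdot> Id X = f"
  using Id_left[of f "Dom f" "Cod f"] Id_right[of f "Dom f" "Cod f"] by (auto simp: mem_hom)

end

context monoidal_category
begin

lemma tensor_arr [simp]: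
  assumes "f \<in> Arr" "g \<in> Arr"
  shows "f \<odot> g \<in> Arr" "Dom (f \<odot> g) = Dom f \<otimes> Dom g" "Cod (f \<odot> g) = Cod f \<otimes> Cod g"
  using tensor_hom[of f "Dom f" "Cod f" g "Dom g" "Cod g"] assms by (auto simp: mem_hom)

lemma tensor_comp [simp]:
  assumes "f \<in> Arr" "f' \<in> Arr" "g \<in> Arr" "g' \<in> Arr" "Cod f = Dom f'" "Cod g = Dom g'"
  shows "(f' \<odot> g') \<cdot> (f \<odot> g) = (f' \<cdot> f) \<odot> (g' \<cdot> g)"
  using interchange[of f "Dom f" "Cod f" f' "Cod f'" g "Dom g" "Cod g" g' "Cod g'"] assms
  by (auto simp: mem_hom)

text \<open>The simplifier nests composites to the right, so two tensor products at the head of a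
  longer composite are out of reach of \<open>tensor_comp\<close>. This variant fuses them
  there.\<close>

lemma tensor_comp_assoc [simp]:
  assumes "f \<in> Arr" "f' \<in> Arr" "g \<in> Arr" "g' \<in> Arr" "Cod f = Dom f'" "Cod g = Dom g'"
    and "h \<in> Arr" "Cod h = Dom f \<otimes> Dom g"
  shows "(f' \<odot> g') \<cdot> ((f \<odot> g) \<cdot> h) = ((f' \<cdot> f) \<odot> (g' \<cdot> g)) \<cdot> h"
  using assms comp_assoc[of h "f \<odot> g" "f' \<odot> g'", symmetric] by simp

lemmas strict_simps [simp] = tensor_obj_closed unit_closed tensor_Id tensor_obj_assoc
  tensor_arr_assoc unit_obj_left unit_obj_right unit_arr_left unit_arr_right

lemma Id_tensor_Id:
  "X \<in> Obj \<Longrightarrow> Y \<in> Obj \<Longrightarrow> f \<in> Arr \<Longrightarrow> Id (X \<otimes> Y) \<odot> f = Id X \<odot> (Id Y \<odot> f)"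
  using tensor_arr_assoc[of "Id X" "Id Y" f] by simp

text \<open>Both sides are \<open>f \<odot> g\<close>, because tensoring with
  \<open>Id \<one>\<close> changes nothing. The next lemma does the same for arrows out of
  \<open>\<one>\<close>.\<close>

lemma slide_unit_cod:
  assumes "f \<in> Arr" "g \<in> Arr" "Cod f = \<one>" "Cod g = \<one>"
  shows "g \<cdot> (f \<odot> Id (Dom g)) = f \<cdot> (Id (Dom f) \<odot> g)"
  using tensor_comp[of f "Id \<one>" "Id (Dom g)" g] tensor_comp[of "Id (Dom f)" f g "Id \<one>"] assms
  by simp

lemma slide_unit_dom:
  assumes "f \<in> Arr" "g \<in> Arr" "Dom f = \<one>" "Dom g = \<one>"
  shows "(Id (Cod f) \<odot> g) \<cdot> f = (f \<odot> Id (Cod g)) \<cdot> g"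
  using tensor_comp[of f "Id (Cod f)" "Id \<one>" g] tensor_comp[of "Id \<one>" f g "Id (Cod g)"] assms
  by simp

lemma left_dualD:
  assumes "left_dual C X X' e c"
  shows "X' \<in> Obj" "e \<in> Arr" "Dom e = X' \<otimes> X" "Cod e = \<one>"
    "c \<in> Arr" "Dom c = \<one>" "Cod c = X \<otimes> X'"
    "(Id X \<odot> e) \<cdot> (c \<odot> Id X) = Id X" "(e \<odot> Id X') \<cdot> (Id X' \<odot> c) = Id X'"
  using assms by (auto simp: left_dual_def mem_hom)

end

section \<open>Comonoidal functors and cancellation\<close>

text \<open>The data are loose parameters rather than a record, and only the comonoidal part of a
  bimonad is axiomatised, so that the identity functor and the square of \<open>T\<close> are
  instances alongside \<open>T\<close>.\<close>

locale comonoidal_functor = monoidal_category C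
  for C :: "('o, 'a, 'z) moncat_scheme" (structure) +
  fixes Fo :: "'o \<Rightarrow> 'o" and Fa :: "'a \<Rightarrow> 'a" and F2 :: "'o \<Rightarrow> 'o \<Rightarrow> 'a" and F0 :: 'a
  assumes Fo_Obj [simp]: "X \<in> Obj \<Longrightarrow> Fo X \<in> Obj"
    and Fa_hom: "f \<in> hom C X Y \<Longrightarrow> Fa f \<in> hom C (Fo X) (Fo Y)"
    and Fa_Id [simp]: "X \<in> Obj \<Longrightarrow> Fa (Id X) = Id (Fo X)"
    and Fa_Comp: "f \<in> hom C X Y \<Longrightarrow> g \<in> hom C Y Z \<Longrightarrow> Fa (g \<cdot> f) = Fa g \<cdot> Fa f"
    and F2_hom: "X \<in> Obj \<Longrightarrow> Y \<in> Obj \<Longrightarrow> F2 X Y \<in> hom C (Fo (X \<otimes> Y)) (Fo X \<otimes> Fo Y)"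
    and F2_natural: "f \<in> hom C X X' \<Longrightarrow> g \<in> hom C Y Y' \<Longrightarrow>
          F2 X' Y' \<cdot> Fa (f \<odot> g) = (Fa f \<odot> Fa g) \<cdot> F2 X Y"
    and F0_hom: "F0 \<in> hom C (Fo \<one>) \<one>"
    and F2_coassoc: "X \<in> Obj \<Longrightarrow> Y \<in> Obj \<Longrightarrow> Z \<in> Obj \<Longrightarrow>
          (Id (Fo X) \<odot> F2 Y Z) \<cdot> F2 X (Y \<otimes> Z) = (F2 X Y \<odot> Id (Fo Z)) \<cdot> F2 (X \<otimes> Y) Z"
    and F2_counit_right [simp]: "X \<in> Obj \<Longrightarrow> (Id (Fo X) \<odot> F0) \<cdot> F2 X \<one> = Id (Fo X)"
    and F2_counit_left [simp]: "X \<in> Obj \<Longrightarrow> (F0 \<odot> Id (Fo X)) \<cdot> F2 \<one> X = Id (Fo X)"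
begin

lemma F_arr [simp]:
  "f \<in> Arr \<Longrightarrow> Fa f \<in> Arr" "f \<in> Arr \<Longrightarrow> Dom (Fa f) = Fo (Dom f)" "f \<in> Arr \<Longrightarrow> Cod (Fa f) = Fo (Cod f)"
  "X \<in> Obj \<Longrightarrow> Y \<in> Obj \<Longrightarrow> F2 X Y \<in> Arr"
  "X \<in> Obj \<Longrightarrow> Y \<in> Obj \<Longrightarrow> Dom (F2 X Y) = Fo (X \<otimes> Y)"
  "X \<in> Obj \<Longrightarrow> Y \<in> Obj \<Longrightarrow> Cod (F2 X Y) = Fo X \<otimes> Fo Y"
  "F0 \<in> Arr" "Dom F0 = Fo \<one>" "Cod F0 = \<one>"
  using Fa_hom[of f "Dom f" "Cod f"] F2_hom[of X Y] F0_hom by (auto simp: mem_hom)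

lemma Fa_comp [simp]:
  "f \<in> Arr \<Longrightarrow> g \<in> Arr \<Longrightarrow> Cod f = Dom g \<Longrightarrow> Fa (g \<cdot> f) = Fa g \<cdot> Fa f"
  using Fa_Comp[of f "Dom f" "Cod f" g "Cod g"] by (auto simp: mem_hom)

lemma F2_nat:
  "f \<in> Arr \<Longrightarrow> g \<in> Arr \<Longrightarrow> Cod f = X \<Longrightarrow> Cod g = Y \<Longrightarrow>
    F2 X Y \<cdot> Fa (f \<odot> g) = (Fa f \<odot> Fa g) \<cdot> F2 (Dom f) (Dom g)"
  using F2_natural[of f "Dom f" "Cod f" g "Dom g" "Cod g"] by (auto simp: mem_hom)

lemma F2_nat_assoc:
  assumes "f \<in> Arr" "g \<in> Arr" "Cod f = X" "Cod g = Y" "h \<in> Arr" "Cod h = Fo (Dom f \<otimes> Dom g)"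
  shows "F2 X Y \<cdot> (Fa (f \<odot> g) \<cdot> h) = (Fa f \<odot> Fa g) \<cdot> (F2 (Dom f) (Dom g) \<cdot> h)"
proof -
  have "X \<in> Obj" "Y \<in> Obj" using assms cat_arr(2) by blast+
  then show ?thesis
    using F2_nat[OF assms(1-4)] comp_assoc[of h "Fa (f \<odot> g)" "F2 X Y"] assms by simp
qed

text \<open>Coassociativity and naturality of \<open>F2\<close> gather \<open>r\<close>,
  \<open>r'\<close> and \<open>c\<close> into the left side of \<open>coev\<close>. Once this is
  replaced by \<open>k \<cdot> F0\<close>, the counit law absorbs \<open>F0\<close> and a triangle
  identity absorbs \<open>e\<close> and \<open>k\<close>. So \<open>g\<close> can be rebuilt from
  its pairing \<open>e \<cdot> (g \<odot> r) \<cdot> F2 A M\<close> alone.\<close>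

lemma recover:
  assumes K: "left_dual C K K' e k" "K \<in> Obj" and c: "c \<in> hom C \<one> (M \<otimes> M')"
    and obj [simp]: "M \<in> Obj" "M' \<in> Obj" "A \<in> Obj"
    and r: "r \<in> hom C (Fo M) K" and r': "r' \<in> hom C (Fo M') K'"
    and coev: "(r \<odot> r') \<cdot> F2 M M' \<cdot> Fa c = k \<cdot> F0"
    and g: "g \<in> hom C (Fo A) K'"
  shows "((e \<cdot> (g \<odot> r) \<cdot> F2 A M) \<odot> r') \<cdot> F2 (A \<otimes> M) M' \<cdot> Fa (Id A \<odot> c) = g"
proof -
  note [simp] = left_dualD(1-8)[OF K(1)] K(2) and tri = left_dualD(9)[OF K(1)]
  have [simp]: "c \<in> Arr" "Dom c = \<one>" "Cod c = M \<otimes> M'" "r \<in> Arr" "Dom r = Fo M" "Cod r = K"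
    "r' \<in> Arr" "Dom r' = Fo M'" "Cod r' = K'" "g \<in> Arr" "Dom g = Fo A" "Cod g = K'"
    using c r r' g by (auto simp: mem_hom)
  have "((e \<cdot> (g \<odot> r) \<cdot> F2 A M) \<odot> r') \<cdot> F2 (A \<otimes> M) M' \<cdot> Fa (Id A \<odot> c) =
    ((e \<odot> Id K') \<cdot> (g \<odot> r \<odot> r')) \<cdot> ((F2 A M \<odot> Id (Fo M')) \<cdot> F2 (A \<otimes> M) M') \<cdot> Fa (Id A \<odot> c)"
    by (simp del: tensor_arr_assoc)
  also have "\<dots> = ((e \<odot> Id K') \<cdot> (g \<odot> (r \<odot> r') \<cdot> (Id (Fo A) \<odot> F2 M M'))) \<cdot> (F2 A (M \<otimes> M') \<cdot> Fa (Id A \<odot> c))"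
    by (subst F2_coassoc[symmetric]) simp_all
  also have "\<dots> = (e \<odot> Id K') \<cdot> (g \<odot> ((r \<odot> r') \<cdot> F2 M M' \<cdot> Fa c)) \<cdot> F2 A \<one>"
    by (subst F2_nat) simp_all
  also have "\<dots> = (e \<odot> Id K') \<cdot> (g \<odot> (k \<cdot> F0)) \<cdot> F2 A \<one>"
    by (simp only: coev)
  also have "\<dots> = ((e \<odot> Id K') \<cdot> (Id K' \<odot> k)) \<cdot> (g \<odot> Id \<one>) \<cdot> ((Id (Fo A) \<odot> F0) \<cdot> F2 A \<one>)"
    by (simp del: F2_counit_right unit_arr_right)
  also have "\<dots> = g" using tri by simp
  finally show ?thesis .
qed

text \<open>\<open>recover\<close> rebuilds \<open>g\<close> and \<open>h\<close> by one formula
  from their pairings with \<open>r\<close>, and the last assumption equates these pairings.\<close>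

lemma cancel:
  assumes "left_dual C K K' e k" "K \<in> Obj" "c \<in> hom C \<one> (M \<otimes> M')" "M \<in> Obj" "M' \<in> Obj" "A \<in> Obj"
    and "r \<in> hom C (Fo M) K" "r' \<in> hom C (Fo M') K'" "(r \<odot> r') \<cdot> F2 M M' \<cdot> Fa c = k \<cdot> F0"
    and "g \<in> hom C (Fo A) K'" "h \<in> hom C (Fo A) K'"
    and "e \<cdot> (g \<odot> r) \<cdot> F2 A M = e \<cdot> (h \<odot> r) \<cdot> F2 A M"
  shows "g = h"
  using recover[OF assms(1-10)] unfolding assms(12) recover[OF assms(1-9,11)] by (rule sym)

text \<open>Coassociativity and the counit laws use those of \<open>F\<close> twice, once outside
  and once under \<open>Fa\<close>; naturality of \<open>F2\<close> moves the inner arrows past the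
  outer \<open>F2\<close>. The instance makes \<open>cancel\<close> available for arrows out of
  \<open>Fo (Fo A)\<close>, as the associativity of an action requires.\<close>

lemma comp_self:
  "comonoidal_functor C (\<lambda>X. Fo (Fo X)) (\<lambda>f. Fa (Fa f)) (\<lambda>X Y. F2 (Fo X) (Fo Y) \<cdot> Fa (F2 X Y)) (F0 \<cdot> Fa F0)"
proof unfold_locales
  fix f X Y assume "f \<in> hom C X Y"
  then show "Fa (Fa f) \<in> hom C (Fo (Fo X)) (Fo (Fo Y))" by (intro Fa_hom)
next
  fix f g X Y Z assume "f \<in> hom C X Y" "g \<in> hom C Y Z"
  then show "Fa (Fa (g \<cdot> f)) = Fa (Fa g) \<cdot> Fa (Fa f)" by (simp add: mem_hom)
next
  fix X Y assume "X \<in> Obj" "Y \<in> Obj"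
  then show "F2 (Fo X) (Fo Y) \<cdot> Fa (F2 X Y) \<in> hom C (Fo (Fo (X \<otimes> Y))) (Fo (Fo X) \<otimes> Fo (Fo Y))"
    by (simp add: mem_hom)
next
  fix f g X X' Y Y' assume "f \<in> hom C X X'" "g \<in> hom C Y Y'"
  then have fg [simp]: "f \<in> Arr" "Dom f = X" "Cod f = X'" "g \<in> Arr" "Dom g = Y" "Cod g = Y'"
    by (auto simp: mem_hom)
  have [simp]: "X \<in> Obj" "X' \<in> Obj" "Y \<in> Obj" "Y' \<in> Obj"
    using cat_arr(1,2)[of f] cat_arr(1,2)[of g] by simp_all
  have "F2 (Fo X') (Fo Y') \<cdot> Fa (F2 X' Y') \<cdot> Fa (Fa (f \<odot> g)) =
    F2 (Fo X') (Fo Y') \<cdot> Fa (F2 X' Y' \<cdot> Fa (f \<odot> g))" by simp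
  also have "\<dots> = (F2 (Fo X') (Fo Y') \<cdot> Fa (Fa f \<odot> Fa g)) \<cdot> Fa (F2 X Y)"
    by (subst F2_nat) simp_all
  also have "\<dots> = (Fa (Fa f) \<odot> Fa (Fa g)) \<cdot> (F2 (Fo X) (Fo Y) \<cdot> Fa (F2 X Y))"
    by (subst F2_nat) simp_all
  finally show "F2 (Fo X') (Fo Y') \<cdot> Fa (F2 X' Y') \<cdot> Fa (Fa (f \<odot> g)) =
    (Fa (Fa f) \<odot> Fa (Fa g)) \<cdot> (F2 (Fo X) (Fo Y) \<cdot> Fa (F2 X Y))" .
next
  show "F0 \<cdot> Fa F0 \<in> hom C (Fo (Fo \<one>)) \<one>" by (simp add: mem_hom)
next
  fix X Y Z assume [simp]: "X \<in> Obj" "Y \<in> Obj" "Z \<in> Obj"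
  have "(Id (Fo (Fo X)) \<odot> (F2 (Fo Y) (Fo Z) \<cdot> Fa (F2 Y Z))) \<cdot> (F2 (Fo X) (Fo (Y \<otimes> Z)) \<cdot> Fa (F2 X (Y \<otimes> Z)))
    = (Id (Fo (Fo X)) \<odot> F2 (Fo Y) (Fo Z)) \<cdot> ((Fa (Id (Fo X)) \<odot> Fa (F2 Y Z)) \<cdot> F2 (Fo X) (Fo (Y \<otimes> Z))) \<cdot> Fa (F2 X (Y \<otimes> Z))"
    by simp
  also have "\<dots> = ((Id (Fo (Fo X)) \<odot> F2 (Fo Y) (Fo Z)) \<cdot> F2 (Fo X) (Fo Y \<otimes> Fo Z)) \<cdot> Fa ((Id (Fo X) \<odot> F2 Y Z) \<cdot> F2 X (Y \<otimes> Z))"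
    using F2_nat[of "Id (Fo X)" "F2 Y Z" "Fo X" "Fo Y \<otimes> Fo Z", symmetric] by simp
  also have "\<dots> = ((F2 (Fo X) (Fo Y) \<odot> Id (Fo (Fo Z))) \<cdot> F2 (Fo X \<otimes> Fo Y) (Fo Z)) \<cdot> Fa ((F2 X Y \<odot> Id (Fo Z)) \<cdot> F2 (X \<otimes> Y) Z)"
    using F2_coassoc[of X Y Z] F2_coassoc[of "Fo X" "Fo Y" "Fo Z"] by simp
  also have "\<dots> = (F2 (Fo X) (Fo Y) \<odot> Id (Fo (Fo Z))) \<cdot> (F2 (Fo X \<otimes> Fo Y) (Fo Z) \<cdot> Fa (F2 X Y \<odot> Id (Fo Z))) \<cdot> Fa (F2 (X \<otimes> Y) Z)"
    by simp
  also have "\<dots> = ((F2 (Fo X) (Fo Y) \<cdot> Fa (F2 X Y)) \<odot> Id (Fo (Fo Z))) \<cdot> (F2 (Fo (X \<otimes> Y)) (Fo Z) \<cdot> Fa (F2 (X \<otimes> Y) Z))"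
    by (subst F2_nat) simp_all
  finally show "(Id (Fo (Fo X)) \<odot> (F2 (Fo Y) (Fo Z) \<cdot> Fa (F2 Y Z))) \<cdot> (F2 (Fo X) (Fo (Y \<otimes> Z)) \<cdot> Fa (F2 X (Y \<otimes> Z)))
    = ((F2 (Fo X) (Fo Y) \<cdot> Fa (F2 X Y)) \<odot> Id (Fo (Fo Z))) \<cdot> (F2 (Fo (X \<otimes> Y)) (Fo Z) \<cdot> Fa (F2 (X \<otimes> Y) Z))" .
next
  fix X assume [simp]: "X \<in> Obj"
  have "(Id (Fo (Fo X)) \<odot> (F0 \<cdot> Fa F0)) \<cdot> (F2 (Fo X) (Fo \<one>) \<cdot> Fa (F2 X \<one>)) =
    (Id (Fo (Fo X)) \<odot> F0) \<cdot> ((Fa (Id (Fo X)) \<odot> Fa F0) \<cdot> F2 (Fo X) (Fo \<one>)) \<cdot> Fa (F2 X \<one>)"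
    by simp
  also have "\<dots> = ((Id (Fo (Fo X)) \<odot> F0) \<cdot> F2 (Fo X) \<one>) \<cdot> Fa ((Id (Fo X) \<odot> F0) \<cdot> F2 X \<one>)"
    using F2_nat[of "Id (Fo X)" F0 "Fo X" \<one>, symmetric] by (simp del: F2_counit_right)
  finally show "(Id (Fo (Fo X)) \<odot> (F0 \<cdot> Fa F0)) \<cdot> (F2 (Fo X) (Fo \<one>) \<cdot> Fa (F2 X \<one>)) = Id (Fo (Fo X))"
    by simp
  have "((F0 \<cdot> Fa F0) \<odot> Id (Fo (Fo X))) \<cdot> (F2 (Fo \<one>) (Fo X) \<cdot> Fa (F2 \<one> X)) =
    (F0 \<odot> Id (Fo (Fo X))) \<cdot> ((Fa F0 \<odot> Fa (Id (Fo X))) \<cdot> F2 (Fo \<one>) (Fo X)) \<cdot> Fa (F2 \<one> X)"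
    by simp
  also have "\<dots> = ((F0 \<odot> Id (Fo (Fo X))) \<cdot> F2 \<one> (Fo X)) \<cdot> Fa ((F0 \<odot> Id (Fo X)) \<cdot> F2 \<one> X)"
    using F2_nat[of F0 "Id (Fo X)" \<one> "Fo X", symmetric] by (simp del: F2_counit_left)
  finally show "((F0 \<cdot> Fa F0) \<odot> Id (Fo (Fo X))) \<cdot> (F2 (Fo \<one>) (Fo X) \<cdot> Fa (F2 \<one> X)) = Id (Fo (Fo X))"
    by simp
qed simp_all

end

section \<open>Pairing with an evaluation, and mates of arrows\<close>

context monoidal_category
begin

lemma comonoidal_functor_id:
  "comonoidal_functor C (\<lambda>X. X) (\<lambda>f. f) (\<lambda>X Y. Id (X \<otimes> Y)) (Id \<one>)"
  by unfold_locales (simp_all add: mem_hom)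

text \<open>This is \<open>cancel\<close> for the identity functor with identities as
  \<open>r\<close> and \<open>r'\<close>; its condition on \<open>coev\<close> then holds
  trivially.\<close>

lemma left_dual_cancel:
  assumes "left_dual C X X' e c" "X \<in> Obj" and g: "g \<in> hom C A X'" and h: "h \<in> hom C A X'"
    and "e \<cdot> (g \<odot> Id X) = e \<cdot> (h \<odot> Id X)"
  shows "g = h"
proof -
  note [simp] = left_dualD[OF assms(1)] assms(2)
  have [simp]: "g \<in> Arr" "Dom g = A" "Cod g = X'" "h \<in> Arr" "Dom h = A" "Cod h = X'"
    using g h by (auto simp: mem_hom)
  have A [simp]: "A \<in> Obj" using cat_arr(1)[of g] by simp
  show ?thesis
    by (rule comonoidal_functor.cancel[OF comonoidal_functor_id assms(1), of c X X' A "Id X" "Id X'"])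
      (use assms(5) in \<open>simp_all add: mem_hom\<close>)
qed

text \<open>Each slide rule reduces to one triangle identity, that of \<open>X\<close> for the
  evaluation and that of \<open>Y\<close> for the coevaluation. The two dual pairs are arbitrary:
  chosen duals give \<open>left_dual_arr\<close>, and an identity as \<open>f\<close> compares two
  left duals of one object.\<close>

lemma mate:
  assumes X: "left_dual C X X' e c" "X \<in> Obj" and Y: "left_dual C Y Y' e' c'" "Y \<in> Obj"
    and f: "f \<in> hom C X Y"
    and m: "m = (e' \<odot> Id X') \<cdot> (Id Y' \<odot> f \<odot> Id X') \<cdot> (Id Y' \<odot> c)"
  shows "m \<in> hom C Y' X'" "e \<cdot> (m \<odot> Id X) = e' \<cdot> (Id Y' \<odot> f)"
    "(Id Y \<odot> m) \<cdot> c' = (f \<odot> Id X') \<cdot> c"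
proof -
  note X [simp] = left_dualD[OF X(1)] X(2) and Y [simp] = left_dualD[OF Y(1)] Y(2)
  have [simp]: "f \<in> Arr" "Dom f = X" "Cod f = Y" using f by (auto simp: mem_hom)
  show "m \<in> hom C Y' X'" using m by (simp add: mem_hom)
  \<comment> \<open>\<open>w\<close> is the pairing of \<open>Y'\<close> with \<open>X\<close>
    induced by \<open>f\<close>, and \<open>m\<close> arises by bending its input \<open>X\<close>
    with \<open>c\<close>. As an arrow into \<open>\<one>\<close>, \<open>w\<close> can be slid past
    \<open>e\<close>.\<close>
  define w where "w = e' \<cdot> (Id Y' \<odot> f)"
  have w [simp]: "w \<in> Arr" "Dom w = Y' \<otimes> X" "Cod w = \<one>" by (simp_all add: w_def)
  have m': "m = (w \<odot> Id X') \<cdot> (Id Y' \<odot> c)"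
    by (simp add: w_def m del: tensor_arr_assoc)
  have "m \<odot> Id X = (w \<odot> Id X' \<odot> Id X) \<cdot> (Id Y' \<odot> c \<odot> Id X)"
    by (simp add: m' del: tensor_arr_assoc)
  then have "e \<cdot> (m \<odot> Id X) = (e \<cdot> (w \<odot> Id (X' \<otimes> X))) \<cdot> (Id Y' \<odot> c \<odot> Id X)"
    by simp
  also have "e \<cdot> (w \<odot> Id (X' \<otimes> X)) = w \<cdot> (Id Y' \<odot> (Id X \<odot> e))"
    using slide_unit_cod[of w e] Id_tensor_Id[of Y' X e] by simp
  also have "\<dots> \<cdot> (Id Y' \<odot> c \<odot> Id X) = w \<cdot> (Id Y' \<odot> ((Id X \<odot> e) \<cdot> (c \<odot> Id X)))"
    by simp
  also have "\<dots> = w" by simp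
  finally show "e \<cdot> (m \<odot> Id X) = e' \<cdot> (Id Y' \<odot> f)" by (simp add: w_def)
  have "Id Y \<odot> m = (Id Y \<odot> w \<odot> Id X') \<cdot> (Id (Y \<otimes> Y') \<odot> c)"
    by (simp add: m' Id_tensor_Id)
  then have "(Id Y \<odot> m) \<cdot> c' = (Id Y \<odot> w \<odot> Id X') \<cdot> ((Id (Y \<otimes> Y') \<odot> c) \<cdot> c')"
    by simp
  \<comment> \<open>The two coevaluations can be exchanged, since both start at
    \<open>\<one>\<close>; afterwards \<open>e'\<close> meets \<open>c'\<close> in the triangle
    identity of \<open>Y\<close>.\<close>
  also have "(Id (Y \<otimes> Y') \<odot> c) \<cdot> c' = (c' \<odot> Id X \<odot> Id X') \<cdot> c"
    using slide_unit_dom[of c' c] by simp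
  also have "(Id Y \<odot> w \<odot> Id X') \<cdot> ((c' \<odot> Id X \<odot> Id X') \<cdot> c) = (((Id Y \<odot> w) \<cdot> (c' \<odot> Id X)) \<odot> Id X') \<cdot> c"
    by (simp del: tensor_arr_assoc)
  also have "Id Y \<odot> w = (Id Y \<odot> e') \<cdot> (Id (Y \<otimes> Y') \<odot> f)"
    by (simp add: w_def Id_tensor_Id)
  also have "\<dots> \<cdot> (c' \<odot> Id X) = (Id Y \<odot> e') \<cdot> ((c' \<odot> Id Y) \<cdot> (Id \<one> \<odot> f))"
    by (simp del: unit_arr_left)
  also have "\<dots> = ((Id Y \<odot> e') \<cdot> (c' \<odot> Id Y)) \<cdot> f"
    by (subst comp_assoc) simp_all
  also have "\<dots> = f" by simp
  finally show "(Id Y \<odot> m) \<cdot> c' = (f \<odot> Id X') \<cdot> c" .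
qed

end


sublocale bimonad \<subseteq> F: comonoidal_functor C "fob T" "far T" "T2 T" "T0 T"
  by unfold_locales
    (fact fob_closed far_hom far_Id far_Comp T2_hom T2_natural T0_hom T2_coassoc
      T2_counit_right T2_counit_left)+

context monad
begin

lemma mu_arr [simp]:
  "X \<in> Obj \<Longrightarrow> mu T X \<in> Arr" "X \<in> Obj \<Longrightarrow> Dom (mu T X) = fob T (fob T X)"
  "X \<in> Obj \<Longrightarrow> Cod (mu T X) = fob T X"
  using mu_hom by (simp_all add: mem_hom)

lemma eta_arr [simp]:
  "X \<in> Obj \<Longrightarrow> eta T X \<in> Arr" "X \<in> Obj \<Longrightarrow> Dom (eta T X) = X"
  "X \<in> Obj \<Longrightarrow> Cod (eta T X) = fob T X"
  using eta_hom by (simp_all add: mem_hom)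

end

section \<open>Left duals of modules and left antipodes\<close>

locale bimonad_left_duals = bimonad C T
  for C :: "('o, 'a, 'z) moncat_scheme" (structure) and T :: "('o, 'a, 't) bimonad_data_scheme" +
  fixes D :: "('o, 'a, 'd) duals_scheme"
  assumes duals: "left_duals C D"
begin

lemma dual: "X \<in> Obj \<Longrightarrow> left_dual C X (dual D X) (ev D X) (coev D X)"
  using duals by (simp add: left_duals_def)

lemmas dual_simps [simp] = dual[THEN left_dualD(1)] dual[THEN left_dualD(2)] dual[THEN left_dualD(3)]
  dual[THEN left_dualD(4)] dual[THEN left_dualD(5)] dual[THEN left_dualD(6)] dual[THEN left_dualD(7)]

lemma
  assumes f: "f \<in> hom C X Y"
  shows left_dual_arr_hom: "left_dual_arr C D f \<in> hom C (dual D Y) (dual D X)"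
    and ev_left_dual_arr: "ev D X \<cdot> (left_dual_arr C D f \<odot> Id X) = ev D Y \<cdot> (Id (dual D Y) \<odot> f)"
    and coev_left_dual_arr:
      "(Id Y \<odot> left_dual_arr C D f) \<cdot> coev D Y = (f \<odot> Id (dual D X)) \<cdot> coev D X"
proof -
  have f' [simp]: "f \<in> Arr" "Dom f = X" "Cod f = Y" using f by (auto simp: mem_hom)
  have [simp]: "X \<in> Obj" "Y \<in> Obj" using cat_arr(1,2)[of f] by simp_all
  have "left_dual_arr C D f =
    (ev D Y \<odot> Id (dual D X)) \<cdot> (Id (dual D Y) \<odot> f \<odot> Id (dual D X)) \<cdot> (Id (dual D Y) \<odot> coev D X)"
    unfolding left_dual_arr_def f' ..
  note m = mate[OF dual _ dual _ f this]
  show "left_dual_arr C D f \<in> hom C (dual D Y) (dual D X)"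
    "ev D X \<cdot> (left_dual_arr C D f \<odot> Id X) = ev D Y \<cdot> (Id (dual D Y) \<odot> f)"
    "(Id Y \<odot> left_dual_arr C D f) \<cdot> coev D Y = (f \<odot> Id (dual D X)) \<cdot> coev D X"
    by (rule m; simp)+
qed

lemma left_dual_arr [simp]:
  assumes "f \<in> Arr"
  shows "left_dual_arr C D f \<in> Arr" "Dom (left_dual_arr C D f) = dual D (Cod f)"
    "Cod (left_dual_arr C D f) = dual D (Dom f)"
  using left_dual_arr_hom[of f "Dom f" "Cod f"] assms by (auto simp: mem_hom)

text \<open>An arrow into the dual of \<open>Dom f\<close> is known by its pairing, and shifting
  \<open>g\<close> and then \<open>f\<close> through the evaluations gives the same pairing for both
  sides.\<close>

lemma left_dual_arr_comp:
  assumes "f \<in> Arr" "g \<in> Arr" "Cod f = Dom g"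
  shows "left_dual_arr C D (g \<cdot> f) = left_dual_arr C D f \<cdot> left_dual_arr C D g"
proof (rule left_dual_cancel[OF dual, of "Dom f" _ "dual D (Cod g)"])
  note [simp] = assms
  have [simp]: "Dom f \<in> Obj" "Dom g \<in> Obj" "Cod g \<in> Obj" using cat_arr(1,2) assms by auto
  show "Dom f \<in> Obj" "Dom f \<in> Obj"
    "left_dual_arr C D (g \<cdot> f) \<in> hom C (dual D (Cod g)) (dual D (Dom f))"
    "left_dual_arr C D f \<cdot> left_dual_arr C D g \<in> hom C (dual D (Cod g)) (dual D (Dom f))"
    by (simp_all add: mem_hom)
  let ?f = "left_dual_arr C D f" and ?g = "left_dual_arr C D g"
  have "ev D (Dom f) \<cdot> (left_dual_arr C D (g \<cdot> f) \<odot> Id (Dom f)) =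
      ev D (Cod g) \<cdot> (Id (dual D (Cod g)) \<odot> (g \<cdot> f))"
    by (rule ev_left_dual_arr) (simp add: mem_hom)
  also have "\<dots> = (ev D (Cod g) \<cdot> (Id (dual D (Cod g)) \<odot> g)) \<cdot> (Id (dual D (Cod g)) \<odot> f)" by simp
  also have "ev D (Cod g) \<cdot> (Id (dual D (Cod g)) \<odot> g) = ev D (Dom g) \<cdot> (?g \<odot> Id (Dom g))"
    by (rule ev_left_dual_arr[symmetric]) (simp add: mem_hom)
  also have "\<dots> \<cdot> (Id (dual D (Cod g)) \<odot> f) = (ev D (Dom g) \<cdot> (Id (dual D (Dom g)) \<odot> f)) \<cdot> (?g \<odot> Id (Dom f))"
    by simp
  also have "ev D (Dom g) \<cdot> (Id (dual D (Dom g)) \<odot> f) = ev D (Dom f) \<cdot> (?f \<odot> Id (Dom f))"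
    by (rule ev_left_dual_arr[symmetric]) (simp add: mem_hom)
  also have "\<dots> \<cdot> (?g \<odot> Id (Dom f)) = ev D (Dom f) \<cdot> ((?f \<cdot> ?g) \<odot> Id (Dom f))" by simp
  finally show "ev D (Dom f) \<cdot> (left_dual_arr C D (g \<cdot> f) \<odot> Id (Dom f)) =
    ev D (Dom f) \<cdot> ((?f \<cdot> ?g) \<odot> Id (Dom f))" .
qed

lemma left_dual_arr_Id:
  assumes [simp]: "X \<in> Obj"
  shows "left_dual_arr C D (Id X) = Id (dual D X)"
proof (rule left_dual_cancel[OF dual, of X _ "dual D X"])
  show "ev D X \<cdot> (left_dual_arr C D (Id X) \<odot> Id X) = ev D X \<cdot> (Id (dual D X) \<odot> Id X)"
    by (rule ev_left_dual_arr) (simp add: mem_hom)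
qed (simp_all add: mem_hom)

section \<open>Structures on the dual of a module: uniqueness, naturality, action laws\<close>

definition dual_structure :: "'o \<Rightarrow> 'a \<Rightarrow> 'a \<Rightarrow> bool" where
  "dual_structure M r r' \<longleftrightarrow> r' \<in> hom C (fob T (dual D M)) (dual D M) \<and>
     ev D M \<cdot> ((r' \<odot> r) \<cdot> T2 T (dual D M) M) = T0 T \<cdot> far T (ev D M) \<and>
     (r \<odot> r') \<cdot> T2 T M (dual D M) \<cdot> far T (coev D M) = coev D M \<cdot> T0 T"

text \<open>In \<open>cancel\<close> for \<open>T\<close>, the chosen dual pair of \<open>M\<close>
  serves both as \<open>K\<close>, \<open>K'\<close> and as \<open>M\<close>, \<open>M'\<close>; the
  coevaluation equation of a dual structure is the condition asked for there.\<close>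

lemma dual_structure_cancel:
  assumes "dual_structure M r r'" and [simp]: "M \<in> Obj" "A \<in> Obj"
    and r: "r \<in> hom C (fob T M) M"
    and "g \<in> hom C (fob T A) (dual D M)" "h \<in> hom C (fob T A) (dual D M)"
    and "ev D M \<cdot> ((g \<odot> r) \<cdot> T2 T A M) = ev D M \<cdot> ((h \<odot> r) \<cdot> T2 T A M)"
  shows "g = h"
proof -
  have [simp]: "g \<in> Arr" "Dom g = fob T A" "Cod g = dual D M" "h \<in> Arr" "Dom h = fob T A" "Cod h = dual D M"
    "r \<in> Arr" "Dom r = fob T M" "Cod r = M"
    using assms(4-6) by (auto simp: mem_hom)
  have "ev D M \<cdot> (g \<odot> r) \<cdot> T2 T A M = ev D M \<cdot> (h \<odot> r) \<cdot> T2 T A M"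
    using assms(7) by (subst (1 2) comp_assoc) simp_all
  then show ?thesis
    by (rule F.cancel[OF dual _ _ _ _ _ r, where c = "coev D M" and M' = "dual D M" and r' = r' and A = A, rotated -1])
      (use assms(1,5,6) in \<open>simp_all add: dual_structure_def mem_hom\<close>)
qed

text \<open>Linearity of \<open>ev D M\<close> prescribes the pairing of the structure with
  \<open>r\<close>, and the prescribed value \<open>T0 T \<cdot> far T (ev D M)\<close> does not
  mention the structure.\<close>

lemma dual_structure_unique:
  assumes "dual_structure M r r'" "dual_structure M r r''" "M \<in> Obj" "r \<in> hom C (fob T M) M"
  shows "r' = r''"
  by (rule dual_structure_cancel[OF assms(1,3) _ assms(4), of "dual D M"])
    (use assms in \<open>simp_all add: dual_structure_def\<close>)

text \<open>The pairings of both sides with \<open>r\<close> agree: \<open>ev D M\<close> is linear,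
  the dual of \<open>f\<close> is traded for \<open>f\<close> on the other factor,
  \<open>ev D N\<close> and \<open>f\<close> are linear, and \<open>f\<close> is traded back.
  Applied to linear maps between free modules, this yields the naturality of the antipode.\<close>

lemma dual_structure_natural:
  assumes r: "dual_structure M r r'" and t: "dual_structure N t t'"
    and rh: "r \<in> hom C (fob T M) M" and th: "t \<in> hom C (fob T N) N"
    and f: "f \<in> hom C M N" and lin: "f \<cdot> r = t \<cdot> far T f"
  shows "r' \<cdot> far T (left_dual_arr C D f) = left_dual_arr C D f \<cdot> t'"
proof -
  have [simp]: "f \<in> Arr" "Dom f = M" "Cod f = N" "r \<in> Arr" "Dom r = fob T M" "Cod r = M"
    "t \<in> Arr" "Dom t = fob T N" "Cod t = N" "r' \<in> Arr" "Dom r' = fob T (dual D M)" "Cod r' = dual D M"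
    "t' \<in> Arr" "Dom t' = fob T (dual D N)" "Cod t' = dual D N"
    using f rh th r t by (auto simp: mem_hom dual_structure_def)
  have M [simp]: "M \<in> Obj" "N \<in> Obj" using cat_arr(1,2)[of f] by simp_all
  let ?f = "left_dual_arr C D f"
  note ev = ev_left_dual_arr[OF f]
  show ?thesis
  proof (rule dual_structure_cancel[OF r M(1) _ rh, of "dual D N"])
    have "ev D M \<cdot> (((r' \<cdot> far T ?f) \<odot> r) \<cdot> T2 T (dual D N) M) =
      ev D M \<cdot> ((r' \<odot> r) \<cdot> (T2 T (dual D M) M \<cdot> far T (?f \<odot> Id M)))"
      by (simp add: F.F2_nat)
    also have "\<dots> = (ev D M \<cdot> ((r' \<odot> r) \<cdot> T2 T (dual D M) M)) \<cdot> far T (?f \<odot> Id M)"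
      by simp
    also have "\<dots> = (T0 T \<cdot> far T (ev D M)) \<cdot> far T (?f \<odot> Id M)"
      using r by (simp only: dual_structure_def)
    also have "\<dots> = T0 T \<cdot> far T (ev D M \<cdot> (?f \<odot> Id M))" by simp
    also have "\<dots> = T0 T \<cdot> far T (ev D N \<cdot> (Id (dual D N) \<odot> f))" by (simp only: ev)
    also have "\<dots> = (T0 T \<cdot> far T (ev D N)) \<cdot> far T (Id (dual D N) \<odot> f)" by simp
    also have "\<dots> = (ev D N \<cdot> ((t' \<odot> t) \<cdot> T2 T (dual D N) N)) \<cdot> far T (Id (dual D N) \<odot> f)"
      using t by (simp only: dual_structure_def)
    also have "\<dots> = ev D N \<cdot> ((t' \<odot> (t \<cdot> far T f)) \<cdot> T2 T (dual D N) M)"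
      by (simp add: F.F2_nat)
    also have "\<dots> = ev D N \<cdot> ((t' \<odot> (f \<cdot> r)) \<cdot> T2 T (dual D N) M)"
      by (simp only: lin)
    also have "\<dots> = (ev D N \<cdot> (Id (dual D N) \<odot> f)) \<cdot> (t' \<odot> r) \<cdot> T2 T (dual D N) M"
      by simp
    also have "\<dots> = (ev D M \<cdot> (?f \<odot> Id M)) \<cdot> (t' \<odot> r) \<cdot> T2 T (dual D N) M"
      by (simp only: ev)
    also have "\<dots> = ev D M \<cdot> (((?f \<cdot> t') \<odot> r) \<cdot> T2 T (dual D N) M)" by simp
    finally show "ev D M \<cdot> (((r' \<cdot> far T ?f) \<odot> r) \<cdot> T2 T (dual D N) M) =
      ev D M \<cdot> (((?f \<cdot> t') \<odot> r) \<cdot> T2 T (dual D N) M)" .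
  qed (simp_all add: mem_hom)
qed

text \<open>The action laws are not built into \<open>dual_structure\<close> but derived by
  comparing pairings. As \<open>mu\<close> and \<open>eta\<close> are comonoidal and
  \<open>ev\<close> is linear, the laws of \<open>r\<close> carry over to \<open>r'\<close>.\<close>

lemma dual_structure_module:
  assumes mod: "is_module C T (M, r)" and dual_structure: "dual_structure M r r'"
  shows "is_module C T (dual D M, r')"
proof -
  have M [simp]: "M \<in> Obj" and rh: "r \<in> hom C (fob T M) M" and act: "r \<cdot> far T r = r \<cdot> mu T M"
    and unit: "r \<cdot> eta T M = Id M"
    using mod by (auto simp: is_module_def)
  have r'h: "r' \<in> hom C (fob T (dual D M)) (dual D M)"
    and ev: "ev D M \<cdot> ((r' \<odot> r) \<cdot> T2 T (dual D M) M) = T0 T \<cdot> far T (ev D M)"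
    and coev: "(r \<odot> r') \<cdot> T2 T M (dual D M) \<cdot> far T (coev D M) = coev D M \<cdot> T0 T"
    using dual_structure by (auto simp: dual_structure_def)
  have [simp]: "r \<in> Arr" "Dom r = fob T M" "Cod r = M"
    "r' \<in> Arr" "Dom r' = fob T (dual D M)" "Cod r' = dual D M"
    using rh r'h by (auto simp: mem_hom)
  let ?N = "dual D M"
  let ?T2 = "T2 T (fob T ?N) (fob T M) \<cdot> far T (T2 T ?N M)"
  have "r' \<cdot> far T r' = r' \<cdot> mu T ?N"
  \<comment> \<open>Cancellation for \<open>T \<circ> T\<close> with the iterated actions
    \<open>r \<cdot> far T r\<close> and \<open>r' \<cdot> far T r'\<close>. Its coevaluation
    condition comes from using \<open>coev\<close> twice, once under \<open>far T\<close>.\<close>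
  proof (rule comonoidal_functor.cancel[OF F.comp_self dual M, of "coev D M" M ?N ?N "r \<cdot> far T r" "r' \<cdot> far T r'"])
    have "((r \<cdot> far T r) \<odot> (r' \<cdot> far T r')) \<cdot> (T2 T (fob T M) (fob T ?N) \<cdot> far T (T2 T M ?N)) \<cdot> far T (far T (coev D M))
      = (r \<odot> r') \<cdot> (T2 T M ?N \<cdot> far T ((r \<odot> r') \<cdot> T2 T M ?N \<cdot> far T (coev D M)))"
      by (simp add: F.F2_nat_assoc)
    also have "\<dots> = (r \<odot> r') \<cdot> (T2 T M ?N \<cdot> far T (coev D M \<cdot> T0 T))"
      by (simp only: coev)
    also have "\<dots> = ((r \<odot> r') \<cdot> T2 T M ?N \<cdot> far T (coev D M)) \<cdot> far T (T0 T)"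
      by simp
    also have "\<dots> = coev D M \<cdot> (T0 T \<cdot> far T (T0 T))"
      unfolding coev by simp
    finally show "((r \<cdot> far T r) \<odot> (r' \<cdot> far T r')) \<cdot> (T2 T (fob T M) (fob T ?N) \<cdot> far T (T2 T M ?N)) \<cdot> far T (far T (coev D M))
      = coev D M \<cdot> (T0 T \<cdot> far T (T0 T))" .
    have "ev D M \<cdot> ((r' \<cdot> far T r') \<odot> (r \<cdot> far T r)) \<cdot> ?T2 =
      (ev D M \<cdot> ((r' \<odot> r) \<cdot> T2 T ?N M)) \<cdot> far T ((r' \<odot> r) \<cdot> T2 T ?N M)"
      by (simp add: F.F2_nat_assoc)
    also have "\<dots> = (T0 T \<cdot> far T (ev D M)) \<cdot> far T ((r' \<odot> r) \<cdot> T2 T ?N M)"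
      by (simp only: ev)
    also have "\<dots> = T0 T \<cdot> far T (ev D M \<cdot> ((r' \<odot> r) \<cdot> T2 T ?N M))"
      by simp
    also have "\<dots> = (T0 T \<cdot> far T (T0 T)) \<cdot> far T (far T (ev D M))"
      unfolding ev by simp
    \<comment> \<open>\<open>T0_mu\<close> trades the inner counit for \<open>mu T \<one>\<close>;
      naturality moves it to the right, where \<open>T2_mu\<close> splits it into the
      multiplications of the two factors.\<close>
    also have "\<dots> = T0 T \<cdot> (mu T \<one> \<cdot> far T (far T (ev D M)))"
      unfolding T0_mu[symmetric] by simp
    also have "mu T \<one> \<cdot> far T (far T (ev D M)) = far T (ev D M) \<cdot> mu T (?N \<otimes> M)"
      by (rule mu_natural) (simp add: mem_hom)
    also have "T0 T \<cdot> (far T (ev D M) \<cdot> mu T (?N \<otimes> M)) = (T0 T \<cdot> far T (ev D M)) \<cdot> mu T (?N \<otimes> M)"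
      by simp
    also have "\<dots> = ev D M \<cdot> (r' \<odot> r) \<cdot> (T2 T ?N M \<cdot> mu T (?N \<otimes> M))"
      unfolding ev[symmetric] by simp
    also have "\<dots> = ev D M \<cdot> ((r' \<cdot> mu T ?N) \<odot> (r \<cdot> mu T M)) \<cdot> ?T2"
      by (simp add: T2_mu)
    also have "r \<cdot> mu T M = r \<cdot> far T r" by (simp only: act)
    finally show "ev D M \<cdot> ((r' \<cdot> far T r') \<odot> (r \<cdot> far T r)) \<cdot> ?T2 =
      ev D M \<cdot> ((r' \<cdot> mu T ?N) \<odot> (r \<cdot> far T r)) \<cdot> ?T2" .
  qed (simp_all add: mem_hom)
  moreover have "r' \<cdot> eta T ?N = Id ?N"
  proof (rule left_dual_cancel[OF dual M])
    \<comment> \<open>\<open>Id M\<close> becomes \<open>r \<cdot> eta T M\<close>, so that both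
      factors carry a unit and \<open>T2_eta\<close> merges the two into one.\<close>
    have "ev D M \<cdot> ((r' \<cdot> eta T ?N) \<odot> Id M) = ev D M \<cdot> ((r' \<cdot> eta T ?N) \<odot> (r \<cdot> eta T M))"
      by (simp only: unit)
    also have "\<dots> = ev D M \<cdot> (r' \<odot> r) \<cdot> (T2 T ?N M \<cdot> eta T (?N \<otimes> M))"
      by (simp add: T2_eta)
    also have "\<dots> = (ev D M \<cdot> ((r' \<odot> r) \<cdot> T2 T ?N M)) \<cdot> eta T (?N \<otimes> M)"
      by simp
    also have "\<dots> = T0 T \<cdot> (far T (ev D M) \<cdot> eta T (?N \<otimes> M))"
      unfolding ev by simp
    also have "far T (ev D M) \<cdot> eta T (?N \<otimes> M) = eta T \<one> \<cdot> ev D M"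
      by (rule eta_natural[symmetric]) (simp add: mem_hom)
    also have "T0 T \<cdot> (eta T \<one> \<cdot> ev D M) = (T0 T \<cdot> eta T \<one>) \<cdot> ev D M" by simp
    also have "\<dots> = ev D M \<cdot> (Id ?N \<odot> Id M)" unfolding T0_eta by simp
    finally show "ev D M \<cdot> ((r' \<cdot> eta T ?N) \<odot> Id M) = ev D M \<cdot> (Id ?N \<odot> Id M)" .
  qed (simp_all add: mem_hom)
  ultimately show ?thesis using r'h by (simp add: is_module_def)
qed

text \<open>Module arrows compose as in \<open>C\<close>, so the triangle identities are inherited;
  \<open>tensor_module_unit\<close> matches sources and targets, and \<open>dual_structure\<close>
  supplies the linearity of both arrows.\<close>

lemma left_dual_modules:
  assumes "is_module C T (M, r)" and "dual_structure M r r'"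
  shows "left_dual (modules C T) (M, r) (dual D M, r')
    (tensor_module C T (dual D M, r') (M, r), ev D M, (\<one>, T0 T))
    ((\<one>, T0 T), coev D M, tensor_module C T (M, r) (dual D M, r'))"
proof -
  have M [simp]: "M \<in> Obj" "r \<in> Arr" "Dom r = fob T M" "Cod r = M"
    using assms(1) by (auto simp: is_module_def mem_hom)
  have r' [simp]: "r' \<in> Arr" "Dom r' = fob T (dual D M)" "Cod r' = dual D M"
    using assms(2) by (auto simp: dual_structure_def mem_hom)
  have m: "is_module C T (dual D M, r')" using assms by (rule dual_structure_module)
  have "(r \<odot> r') \<cdot> T2 T M (dual D M) \<cdot> far T (coev D M) = coev D M \<cdot> T0 T"
    "ev D M \<cdot> ((r' \<odot> r) \<cdot> T2 T (dual D M) M) = T0 T \<cdot> far T (ev D M)"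
    using assms(2) by (simp_all only: dual_structure_def)
  then show ?thesis
    using dual[OF M(1)] assms(1) m
    by (simp add: left_dual_def mod_sel hom_mod tensor_module_def tensor_module_closed unit_module
        tensor_module_unit)
qed

text \<open>The antipode axioms concern \<open>fob T M\<close>, and the action laws of
  \<open>r\<close> lead back to \<open>M\<close>. For \<open>ev\<close>, trading \<open>r\<close>
  for its dual and naturality of \<open>s\<close> at \<open>r\<close> produce the dual of
  \<open>r \<cdot> far T r\<close>, which associativity turns into that of
  \<open>r \<cdot> mu T M\<close>; then \<open>antipode_ev\<close> applies and the unit law removes
  the dual of \<open>r \<cdot> eta T M\<close>. For \<open>coev\<close>, associativity produces the
  \<open>mu\<close> of \<open>antipode_coev\<close>.\<close>

lemma antipode_dual_structure:
  assumes s: "left_antipode C T D s" and mod: "is_module C T (M, r)"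
  shows "dual_structure M r (s M \<cdot> far T (left_dual_arr C D r))"
proof -
  interpret s: left_antipode C T D s by (fact s)
  have M [simp]: "M \<in> Obj" and rh: "r \<in> hom C (fob T M) M" and act: "r \<cdot> far T r = r \<cdot> mu T M"
    and unit: "r \<cdot> eta T M = Id M"
    using mod by (auto simp: is_module_def)
  have r [simp]: "r \<in> Arr" "Dom r = fob T M" "Cod r = M" using rh by (auto simp: mem_hom)
  have [simp]: "s X \<in> Arr" "Dom (s X) = fob T (dual D (fob T X))" "Cod (s X) = dual D X" if "X \<in> Obj" for X
    using s.antipode_hom[OF that] by (auto simp: mem_hom)
  let ?d = "left_dual_arr C D" and ?N = "dual D M" and ?TM = "fob T M"
  have d: "?d r \<cdot> s M = s ?TM \<cdot> far T (?d (far T r))" using s.antipode_natural[OF rh] by simp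
  have dd: "?d (far T r) \<cdot> ?d r = ?d (mu T M) \<cdot> ?d r"
    using left_dual_arr_comp[of "far T r" r] left_dual_arr_comp[of "mu T M" r] act by simp
  have "ev D M \<cdot> (((s M \<cdot> far T (?d r)) \<odot> r) \<cdot> T2 T ?N M) =
    (ev D M \<cdot> (Id ?N \<odot> r)) \<cdot> (((s M \<cdot> far T (?d r)) \<odot> Id ?TM) \<cdot> T2 T ?N M)"
    by simp
  also have "\<dots> = (ev D ?TM \<cdot> (?d r \<odot> Id ?TM)) \<cdot> (((s M \<cdot> far T (?d r)) \<odot> Id ?TM) \<cdot> T2 T ?N M)"
    by (simp only: ev_left_dual_arr[OF rh])
  also have "\<dots> = ev D ?TM \<cdot> ((((?d r \<cdot> s M) \<cdot> far T (?d r)) \<odot> Id ?TM) \<cdot> T2 T ?N M)"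
    by simp
  also have "(?d r \<cdot> s M) \<cdot> far T (?d r) = s ?TM \<cdot> far T (?d (far T r) \<cdot> ?d r)"
    unfolding d by simp
  also have "\<dots> = s ?TM \<cdot> far T (?d (mu T M)) \<cdot> far T (?d r)"
    unfolding dd by simp
  also have "ev D ?TM \<cdot> (((s ?TM \<cdot> far T (?d (mu T M)) \<cdot> far T (?d r)) \<odot> Id ?TM) \<cdot> T2 T ?N M) =
    (ev D ?TM \<cdot> ((s ?TM \<cdot> far T (?d (mu T M))) \<odot> Id ?TM) \<cdot> T2 T (dual D ?TM) M) \<cdot> far T (?d r \<odot> Id M)"
    by (simp add: F.F2_nat)
  also have "\<dots> = (T0 T \<cdot> far T (ev D M) \<cdot> far T (?d (eta T M) \<odot> Id M)) \<cdot> far T (?d r \<odot> Id M)"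
    unfolding s.antipode_ev[OF M] ..
  also have "\<dots> = T0 T \<cdot> far T (ev D M \<cdot> ((?d (eta T M) \<cdot> ?d r) \<odot> Id M))"
    using F.Fa_comp[of "?d r \<odot> Id M" "?d (eta T M) \<odot> Id M", symmetric]
    by simp
  also have "?d (eta T M) \<cdot> ?d r = Id ?N"
    using left_dual_arr_comp[of "eta T M" r] unit left_dual_arr_Id[OF M] by simp
  finally have 1: "ev D M \<cdot> (((s M \<cdot> far T (?d r)) \<odot> r) \<cdot> T2 T ?N M) = T0 T \<cdot> far T (ev D M)"
    by simp
  have "(r \<odot> (s M \<cdot> far T (?d r))) \<cdot> T2 T M ?N \<cdot> far T (coev D M) =
    (r \<odot> s M) \<cdot> T2 T M (dual D ?TM) \<cdot> far T ((Id M \<odot> ?d r) \<cdot> coev D M)"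
    by (simp add: F.F2_nat_assoc)
  also have "\<dots> = (r \<odot> s M) \<cdot> T2 T M (dual D ?TM) \<cdot> far T ((r \<odot> Id (dual D ?TM)) \<cdot> coev D ?TM)"
    by (simp only: coev_left_dual_arr[OF rh])
  also have "\<dots> = ((r \<cdot> far T r) \<odot> s M) \<cdot> T2 T ?TM (dual D ?TM) \<cdot> far T (coev D ?TM)"
    by (simp add: F.F2_nat_assoc)
  also have "\<dots> = ((r \<cdot> mu T M) \<odot> s M) \<cdot> T2 T ?TM (dual D ?TM) \<cdot> far T (coev D ?TM)"
    by (simp only: act)
  also have "\<dots> = (r \<odot> Id ?N) \<cdot> ((mu T M \<odot> s M) \<cdot> T2 T ?TM (dual D ?TM) \<cdot> far T (coev D ?TM))"
    by simp
  also have "\<dots> = (r \<odot> Id ?N) \<cdot> ((eta T M \<odot> Id ?N) \<cdot> coev D M \<cdot> T0 T)"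
    unfolding s.antipode_coev[OF M] ..
  also have "\<dots> = ((r \<cdot> eta T M) \<odot> Id ?N) \<cdot> coev D M \<cdot> T0 T" by simp
  also have "\<dots> = coev D M \<cdot> T0 T" unfolding unit by simp
  finally have 2: "(r \<odot> (s M \<cdot> far T (?d r))) \<cdot> T2 T M ?N \<cdot> far T (coev D M) = coev D M \<cdot> T0 T" .
  show ?thesis unfolding dual_structure_def using 1 2 by (simp add: mem_hom)
qed

section \<open>Antipodes and dual structures on free modules\<close>

lemma free_module: "X \<in> Obj \<Longrightarrow> is_module C T (fob T X, mu T X)"
  using mu_hom mu_assoc mu_eta by (auto simp: is_module_def fob_closed)

text \<open>An antipode induces on each free module a dual structure, which is unique, and the
  antipode can be read off from these structures.\<close>

lemma antipode_unique:
  assumes s: "left_antipode C T D s" and t: "left_antipode C T D t" and X [simp]: "X \<in> Obj"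
  shows "s X = t X"
proof -
  let ?d = "left_dual_arr C D"
  \<comment> \<open>Naturality of \<open>u\<close> at \<open>eta T X\<close> carries the dual of the
    unit under \<open>far T\<close>, where it cancels against the dual of \<open>mu T X\<close> by
    \<open>mu_far_eta\<close>.\<close>
  have recover: "u X = ?d (eta T X) \<cdot> (u (fob T X) \<cdot> far T (?d (mu T X)))" if u: "left_antipode C T D u" for u
  proof -
    interpret u: left_antipode C T D u by (fact u)
    have [simp]: "u X \<in> Arr" "Dom (u X) = fob T (dual D (fob T X))" "Cod (u X) = dual D X" if "X \<in> Obj" for X
      using u.antipode_hom[OF that] by (auto simp: mem_hom)
    have "?d (eta T X) \<cdot> (u (fob T X) \<cdot> far T (?d (mu T X))) =
      (?d (eta T X) \<cdot> u (fob T X)) \<cdot> far T (?d (mu T X))" by simp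
    also have "?d (eta T X) \<cdot> u (fob T X) = u X \<cdot> far T (?d (far T (eta T X)))"
      using u.antipode_natural[OF eta_hom[OF X]] by simp
    also have "\<dots> \<cdot> far T (?d (mu T X)) = u X \<cdot> far T (?d (mu T X \<cdot> far T (eta T X)))"
      by (simp add: left_dual_arr_comp)
    also have "\<dots> = u X" by (simp add: mu_far_eta left_dual_arr_Id)
    finally show ?thesis by simp
  qed
  have "s (fob T X) \<cdot> far T (?d (mu T X)) = t (fob T X) \<cdot> far T (?d (mu T X))"
    by (rule dual_structure_unique[OF antipode_dual_structure[OF s free_module[OF X]]
          antipode_dual_structure[OF t free_module[OF X]]]) (simp_all add: mem_hom)
  then show ?thesis by (simp only: recover[OF s] recover[OF t])
qed

text \<open>The candidate is the formula by which \<open>antipode_unique\<close> reads off an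
  antipode. The two antipode axioms become linearity of \<open>ev\<close> and \<open>coev\<close>
  for free modules, transported along \<open>eta\<close>.\<close>

lemma left_antipode_from_dual_structures:
  assumes a: "\<And>X. X \<in> Obj \<Longrightarrow> dual_structure (fob T X) (mu T X) (a X)"
  shows "left_antipode C T D (\<lambda>X. left_dual_arr C D (eta T X) \<cdot> a X)"
proof -
  let ?d = "left_dual_arr C D"
  have ah [simp]: "a X \<in> Arr" "Dom (a X) = fob T (dual D (fob T X))" "Cod (a X) = dual D (fob T X)"
    if "X \<in> Obj" for X
    using a[OF that] by (auto simp: dual_structure_def mem_hom)
  show ?thesis
  proof unfold_locales
    show "left_duals C D" by (fact duals)
  next
    fix X assume "X \<in> Obj"
    then show "?d (eta T X) \<cdot> a X \<in> hom C (fob T (dual D (fob T X))) (dual D X)"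
      by (simp add: mem_hom)
  next
    fix f X Y assume f: "f \<in> hom C X Y"
    then have [simp]: "f \<in> Arr" "Dom f = X" "Cod f = Y" by (auto simp: mem_hom)
    have X [simp]: "X \<in> Obj" "Y \<in> Obj" using cat_arr(1,2)[of f] by simp_all
    \<comment> \<open>By naturality of \<open>mu\<close>, \<open>far T f\<close> is linear between
      the free modules on \<open>X\<close> and \<open>Y\<close>.\<close>
    have nat: "a X \<cdot> far T (?d (far T f)) = ?d (far T f) \<cdot> a Y"
      by (rule dual_structure_natural[OF a[OF X(1)] a[OF X(2)]])
        (use mu_natural[OF f] in \<open>simp_all add: mem_hom\<close>)
    have "?d (eta T X) \<cdot> a X \<cdot> far T (?d (far T f)) = ?d (eta T X) \<cdot> (a X \<cdot> far T (?d (far T f)))"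
      by simp
    also have "\<dots> = (?d (far T f \<cdot> eta T X)) \<cdot> a Y"
      unfolding nat by (simp add: left_dual_arr_comp)
    also have "\<dots> = (?d (eta T Y \<cdot> f)) \<cdot> a Y"
      by (simp only: eta_natural[OF f])
    also have "\<dots> = ?d f \<cdot> (?d (eta T Y) \<cdot> a Y)"
      by (simp add: left_dual_arr_comp)
    finally show "?d (eta T X) \<cdot> a X \<cdot> far T (?d (far T f)) = ?d f \<cdot> (?d (eta T Y) \<cdot> a Y)" .
  next
    fix X assume X [simp]: "X \<in> Obj"
    let ?TX = "fob T X"
    \<comment> \<open>By \<open>mu_assoc\<close>, \<open>mu T X\<close> is linear from the free
      module on \<open>?TX\<close> to the free module on \<open>X\<close>. With
      \<open>mu_eta\<close> this identifies \<open>a X\<close> with the composite occurring in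
      \<open>antipode_ev\<close>.\<close>
    have nat: "a ?TX \<cdot> far T (?d (mu T X)) = ?d (mu T X) \<cdot> a X"
      by (rule dual_structure_natural[OF a a])
        (use mu_assoc[OF X] in \<open>simp_all add: mem_hom\<close>)
    have "?d (eta T ?TX) \<cdot> a ?TX \<cdot> far T (?d (mu T X)) = ?d (eta T ?TX) \<cdot> (a ?TX \<cdot> far T (?d (mu T X)))"
      by simp
    also have "\<dots> = ?d (mu T X \<cdot> eta T ?TX) \<cdot> a X"
      unfolding nat by (simp add: left_dual_arr_comp)
    also have "\<dots> = a X"
      by (simp add: mu_eta left_dual_arr_Id)
    finally have s: "?d (eta T ?TX) \<cdot> a ?TX \<cdot> far T (?d (mu T X)) = a X" .
    \<comment> \<open>Splitting the identity by \<open>mu_far_eta\<close> supplies the action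
      \<open>mu T X\<close> needed for linearity of \<open>ev\<close>; the remaining
      \<open>eta\<close> moves under \<open>far T\<close> and is traded for its dual.\<close>
    have "ev D ?TX \<cdot> (a X \<odot> Id ?TX) \<cdot> T2 T (dual D ?TX) X =
      ev D ?TX \<cdot> (a X \<odot> (mu T X \<cdot> far T (eta T X))) \<cdot> T2 T (dual D ?TX) X"
      by (simp only: mu_far_eta[OF X])
    also have "\<dots> = (ev D ?TX \<cdot> ((a X \<odot> mu T X) \<cdot> T2 T (dual D ?TX) ?TX)) \<cdot> far T (Id (dual D ?TX) \<odot> eta T X)"
      by (simp add: F.F2_nat)
    also have "\<dots> = T0 T \<cdot> far T (ev D ?TX) \<cdot> far T (Id (dual D ?TX) \<odot> eta T X)"
      using a[OF X] by (simp only: dual_structure_def)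
    also have "\<dots> = T0 T \<cdot> far T (ev D ?TX \<cdot> (Id (dual D ?TX) \<odot> eta T X))"
      by simp
    also have "\<dots> = T0 T \<cdot> far T (ev D X \<cdot> (?d (eta T X) \<odot> Id X))"
      by (simp only: ev_left_dual_arr[OF eta_hom[OF X]])
    also have "\<dots> = T0 T \<cdot> far T (ev D X) \<cdot> far T (?d (eta T X) \<odot> Id X)"
      by simp
    finally show "T0 T \<cdot> far T (ev D X) \<cdot> far T (?d (eta T X) \<odot> Id X) =
      ev D ?TX \<cdot> ((?d (eta T ?TX) \<cdot> a ?TX \<cdot> far T (?d (mu T X))) \<odot> Id ?TX) \<cdot> T2 T (dual D ?TX) X"
      unfolding s by (rule sym)
    have "(mu T X \<odot> (?d (eta T X) \<cdot> a X)) \<cdot> T2 T ?TX (dual D ?TX) \<cdot> far T (coev D ?TX) =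
      (Id ?TX \<odot> ?d (eta T X)) \<cdot> ((mu T X \<odot> a X) \<cdot> T2 T ?TX (dual D ?TX) \<cdot> far T (coev D ?TX))"
      by simp
    also have "\<dots> = (Id ?TX \<odot> ?d (eta T X)) \<cdot> (coev D ?TX \<cdot> T0 T)"
      using a[OF X] by (simp only: dual_structure_def)
    also have "\<dots> = ((Id ?TX \<odot> ?d (eta T X)) \<cdot> coev D ?TX) \<cdot> T0 T"
      by simp
    also have "\<dots> = (eta T X \<odot> Id (dual D X)) \<cdot> coev D X \<cdot> T0 T"
      by (simp only: coev_left_dual_arr[OF eta_hom[OF X]])
    finally show "(eta T X \<odot> Id (dual D X)) \<cdot> coev D X \<cdot> T0 T =
      (mu T X \<odot> (?d (eta T X) \<cdot> a X)) \<cdot> T2 T ?TX (dual D ?TX) \<cdot> far T (coev D ?TX)" by (rule sym)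
  qed
qed

text \<open>Forgetting actions, a dual of \<open>(M, r)\<close> among the modules is a dual
  \<open>N\<close> of \<open>M\<close>, in general not the chosen one. Its action is transported to
  \<open>dual D M\<close>.\<close>

lemma dual_structure_exists:
  assumes "left_autonomous (modules C T)" and mod: "is_module C T (M, r)"
  shows "\<exists>r'. dual_structure M r r'"
proof -
  obtain Q E K where d0: "left_dual (modules C T) (M, r) Q E K"
    using assms unfolding left_autonomous_def mod_sel by blast
  obtain N n where Q: "Q = (N, n)" by (cases Q)
  note d1 = d0[unfolded left_dual_def mod_sel Q tensor_module_def hom_mod prod.case]
  obtain e c where E: "E = ((N \<otimes> M, (n \<odot> r) \<cdot> T2 T N M), e, (\<one>, T0 T))"
      "K = ((\<one>, T0 T), c, (M \<otimes> N, (r \<odot> n) \<cdot> T2 T M N))"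
    and ec: "e \<in> hom C (N \<otimes> M) \<one>" "c \<in> hom C \<one> (M \<otimes> N)"
    and e: "e \<cdot> ((n \<odot> r) \<cdot> T2 T N M) = T0 T \<cdot> far T e"
    and c: "c \<cdot> T0 T = (r \<odot> n) \<cdot> T2 T M N \<cdot> far T c"
    using d1 by blast
  have N: "is_module C T (N, n)" using d1 by blast
  have d: "left_dual C M N e c"
    using d0 moduleD(1)[OF N] ec unfolding left_dual_def Q E by (simp add: mod_sel tensor_module_def)
  have M [simp]: "M \<in> Obj" "r \<in> Arr" "Dom r = fob T M" "Cod r = M"
    and n [simp]: "n \<in> Arr" "Dom n = fob T N" "Cod n = N"
    using mod N by (auto simp: is_module_def mem_hom)
  note d' [simp] = left_dualD(1-7)[OF d]
  have I: "Id M \<in> hom C M M" by (simp add: mem_hom)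
  \<comment> \<open>\<open>f\<close> and \<open>g\<close> are the mates of \<open>Id M\<close>
    between the two dual pairs. They respect evaluations and coevaluations, so
    \<open>f \<cdot> n \<cdot> far T g\<close> inherits linearity from \<open>n\<close>.\<close>
  obtain f where f: "f \<in> hom C N (dual D M)" "ev D M \<cdot> (f \<odot> Id M) = e" "(Id M \<odot> f) \<cdot> c = coev D M"
    using mate[OF dual[OF M(1)] M(1) d M(1) I refl] by auto
  obtain g where g: "g \<in> hom C (dual D M) N" "e \<cdot> (g \<odot> Id M) = ev D M" "(Id M \<odot> g) \<cdot> coev D M = c"
    using mate[OF d M(1) dual[OF M(1)] M(1) I refl] by auto
  have [simp]: "f \<in> Arr" "Dom f = N" "Cod f = dual D M" "g \<in> Arr" "Dom g = dual D M" "Cod g = N"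
    using f g by (auto simp: mem_hom)
  let ?r = "f \<cdot> n \<cdot> far T g" and ?N = "dual D M"
  have "ev D M \<cdot> ((?r \<odot> r) \<cdot> T2 T ?N M) =
    (ev D M \<cdot> (f \<odot> Id M)) \<cdot> ((n \<odot> r) \<cdot> (T2 T N M \<cdot> far T (g \<odot> Id M)))"
    by (simp add: F.F2_nat)
  also have "\<dots> = (e \<cdot> ((n \<odot> r) \<cdot> T2 T N M)) \<cdot> far T (g \<odot> Id M)"
    unfolding f by simp
  also have "\<dots> = T0 T \<cdot> far T (e \<cdot> (g \<odot> Id M))"
    unfolding e by simp
  finally have 1: "ev D M \<cdot> ((?r \<odot> r) \<cdot> T2 T ?N M) = T0 T \<cdot> far T (ev D M)"
    unfolding g .
  have "(r \<odot> ?r) \<cdot> T2 T M ?N \<cdot> far T (coev D M) =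
    (Id M \<odot> f) \<cdot> ((r \<odot> n) \<cdot> T2 T M N \<cdot> far T ((Id M \<odot> g) \<cdot> coev D M))"
    by (simp add: F.F2_nat_assoc)
  also have "\<dots> = (Id M \<odot> f) \<cdot> (c \<cdot> T0 T)"
    unfolding g c ..
  also have "\<dots> = ((Id M \<odot> f) \<cdot> c) \<cdot> T0 T" by simp
  finally have 2: "(r \<odot> ?r) \<cdot> T2 T M ?N \<cdot> far T (coev D M) = coev D M \<cdot> T0 T"
    unfolding f .
  have "dual_structure M r ?r" unfolding dual_structure_def using 1 2 by (simp add: mem_hom)
  then show ?thesis ..
qed

theorem left_antipode_iff: "(\<exists>s. left_antipode C T D s) \<longleftrightarrow> left_autonomous (modules C T)"
proof
  assume "\<exists>s. left_antipode C T D s"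
  then show "left_autonomous (modules C T)"
    using left_dual_modules antipode_dual_structure
    unfolding left_autonomous_def mod_sel by (auto simp del: split_paired_Ex) blast
next
  assume aut: "left_autonomous (modules C T)"
  \<comment> \<open>Dual structures are chosen on free modules only; the resulting antipode
    determines those on all modules.\<close>
  have "\<exists>a. \<forall>X \<in> Obj. dual_structure (fob T X) (mu T X) (a X)"
    using dual_structure_exists[OF aut free_module] by (intro bchoice) blast
  then show "\<exists>s. left_antipode C T D s" using left_antipode_from_dual_structures by blast
qed

theorem left_dual_of_antipode:
  assumes "left_antipode C T D s" "(M, r) \<in> Obj\<^bsub>modules C T\<^esub>"
  defines "P \<equiv> (M, r)" and "Q \<equiv> (dual D M, s M \<cdot> far T (left_dual_arr C D r))"
  shows "left_dual (modules C T) P Q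
    (Q \<otimes>\<^bsub>modules C T\<^esub> P, ev D M, \<one>\<^bsub>modules C T\<^esub>) (\<one>\<^bsub>modules C T\<^esub>, coev D M, P \<otimes>\<^bsub>modules C T\<^esub> Q)"
  using left_dual_modules[OF _ antipode_dual_structure[OF assms(1)]] assms(2)
  by (simp add: mod_sel P_def Q_def)

end


section \<open>Right duals by reversing the tensor product\<close>

definition rev_cat :: "('o, 'a, 'z) moncat_scheme \<Rightarrow> ('o, 'a, 'z) moncat_scheme" where
  "rev_cat C = C\<lparr>tensor_obj := \<lambda>X Y. Y \<otimes> X, tensor_arr := \<lambda>f g. g \<odot> f\<rparr>" for C (structure)

definition rev_bimonad :: "('o, 'a, 't) bimonad_data_scheme \<Rightarrow> ('o, 'a, 't) bimonad_data_scheme" where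
  "rev_bimonad T = T\<lparr>T2 := \<lambda>X Y. T2 T Y X\<rparr>"

lemma rev_simps [simp]:
  "objects (rev_cat C) = objects C" "arrows (rev_cat C) = arrows C" "source (rev_cat C) = source C"
  "target (rev_cat C) = target C" "identity (rev_cat C) = identity C"
  "composite (rev_cat C) = composite C" "unit_obj (rev_cat C) = unit_obj C"
  "tensor_obj (rev_cat C) X Y = tensor_obj C Y X" "tensor_arr (rev_cat C) f g = tensor_arr C g f"
  "hom (rev_cat C) = hom C" "fob (rev_bimonad T) = fob T" "far (rev_bimonad T) = far T"
  "mu (rev_bimonad T) = mu T" "eta (rev_bimonad T) = eta T" "T0 (rev_bimonad T) = T0 T"
  "T2 (rev_bimonad T) X Y = T2 T Y X"
  by (simp_all add: rev_cat_def rev_bimonad_def hom_def fun_eq_iff)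

lemma left_dual_rev_cat: "left_dual (rev_cat C) = right_dual C"
  by (simp add: left_dual_def right_dual_def fun_eq_iff)

lemma left_duals_rev_cat: "left_duals (rev_cat C) = right_duals C"
  by (simp add: left_duals_def right_duals_def left_dual_rev_cat fun_eq_iff)

lemma left_autonomous_rev_cat: "left_autonomous (rev_cat C) = right_autonomous C"
  by (simp add: left_autonomous_def right_autonomous_def left_dual_rev_cat)

lemma is_module_rev: "is_module (rev_cat C) (rev_bimonad T) = is_module C T"
  by (simp add: is_module_def fun_eq_iff)

lemma tensor_module_rev:
  "tensor_module (rev_cat C) (rev_bimonad T) = (\<lambda>P Q. tensor_module C T Q P)"
  by (simp add: tensor_module_def fun_eq_iff)

text \<open>The module axioms do not involve the tensor product, and \<open>rev_bimonad\<close>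
  exchanges the arguments of \<open>T2\<close>, so reversal commutes with forming modules. Right
  duals of modules thereby become left duals over the reversed bimonad.\<close>

lemma modules_rev: "modules (rev_cat C) (rev_bimonad T) = rev_cat (modules C T)"
  by (simp add: modules_def rev_cat_def [of "modules C T"] is_module_rev tensor_module_rev
      fun_eq_iff)

lemma monoidal_category_rev_cat:
  assumes "monoidal_category C"
  shows "monoidal_category (rev_cat C)"
proof -
  interpret monoidal_category C by (fact assms)
  show ?thesis
    by (unfold_locales; unfold rev_simps;
        (rule Dom_closed Cod_closed Id_hom Comp_hom Comp_assoc Id_left Id_right tensor_obj_closed
          unit_closed tensor_hom tensor_Id interchange tensor_obj_assoc[symmetric]
          tensor_arr_assoc[symmetric] unit_obj_left unit_obj_right unit_arr_left unit_arr_right;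
          assumption))
qed

text \<open>Reversal exchanges the two counit laws and the two sides of coassociativity; the other
  axioms go to themselves up to renaming objects and arrows.\<close>

lemma bimonad_rev:
  assumes "bimonad C T"
  shows "bimonad (rev_cat C) (rev_bimonad T)"
proof -
  interpret bimonad C T by (fact assms)
  interpret rev: monoidal_category "rev_cat C"
    by (rule monoidal_category_rev_cat) (rule monoidal_category_axioms)
  show ?thesis
    by (unfold_locales; unfold rev_simps;
        (rule fob_closed far_hom far_Id far_Comp mu_hom mu_natural eta_hom eta_natural mu_assoc
          mu_eta mu_far_eta T2_hom T2_natural T0_hom T2_coassoc[symmetric] T2_counit_left
          T2_counit_right T2_mu T0_mu T2_eta T0_eta; assumption))
qed

text \<open>The two composites bracket the triple tensor product in the middle differently. They
  agree by strict associativity, which is available for arrows of \<open>C\<close> and identities of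
  its objects.\<close>

lemma left_dual_arr_rev_cat:
  assumes "monoidal_category C" "right_duals C D" "f \<in> arrows C"
  shows "left_dual_arr (rev_cat C) D f = right_dual_arr C D f"
proof -
  interpret monoidal_category C by (fact assms(1))
  have "dual D X \<in> Obj\<^bsub>C\<^esub>" if "X \<in> Obj\<^bsub>C\<^esub>" for X
    using assms(2) that by (simp add: right_duals_def right_dual_def)
  then show ?thesis using assms(3) by (simp add: left_dual_arr_def right_dual_arr_def)
qed

lemma left_antipode_rev:
  assumes "bimonad C T"
  shows "left_antipode (rev_cat C) (rev_bimonad T) D s \<longleftrightarrow> right_antipode C T D s"
\<comment> \<open>Both antipode locales include the assumption on duals, so without it both sides
  are false; with it, the two notions of dual arrow can be identified.\<close>
proof (cases "right_duals C D")
  case True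
  interpret bimonad C T by (fact assms)
  note dual_arr = left_dual_arr_rev_cat[OF monoidal_category_axioms True]
  have [simp]: "left_dual_arr (rev_cat C) D f = right_dual_arr C D f"
    "left_dual_arr (rev_cat C) D (far T f) = right_dual_arr C D (far T f)"
    if "f \<in> hom C X Y" for f X Y
    using dual_arr that by (simp_all add: mem_hom)
  have [simp]: "left_dual_arr (rev_cat C) D (eta T X) = right_dual_arr C D (eta T X)"
    "left_dual_arr (rev_cat C) D (mu T X) = right_dual_arr C D (mu T X)" if "X \<in> Obj\<^bsub>C\<^esub>" for X
    using dual_arr that by simp_all
  show ?thesis
    using True bimonad_rev[OF assms] assms
    by (simp add: left_antipode_def left_antipode_axioms_def right_antipode_def
        right_antipode_axioms_def left_duals_rev_cat)
next
  case False
  then show ?thesis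
    by (simp add: left_antipode_def left_antipode_axioms_def right_antipode_def
        right_antipode_axioms_def left_duals_rev_cat)
qed

section \<open>Transport of the results to right antipodes\<close>

theorem right_antipode_iff:
  assumes "bimonad C T" "right_duals C D"
  shows "(\<exists>s. right_antipode C T D s) \<longleftrightarrow> right_autonomous (modules C T)"
proof -
  interpret rev: bimonad_left_duals "rev_cat C" "rev_bimonad T" D
    using bimonad_rev[OF assms(1)] assms(2)
    by (simp add: bimonad_left_duals_def bimonad_left_duals_axioms_def left_duals_rev_cat)
  show ?thesis
    using rev.left_antipode_iff
    unfolding left_antipode_rev[OF assms(1)] modules_rev left_autonomous_rev_cat .
qed

theorem right_antipode_unique:
  assumes "bimonad C T" "right_antipode C T D s" "right_antipode C T D t" "X \<in> objects C"
  shows "s X = t X"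
proof -
  have D: "right_duals C D"
    using assms(2) by (rule right_antipode.duals)
  interpret rev: bimonad_left_duals "rev_cat C" "rev_bimonad T" D
    using bimonad_rev[OF assms(1)] D
    by (simp add: bimonad_left_duals_def bimonad_left_duals_axioms_def left_duals_rev_cat)
  show ?thesis
    using rev.antipode_unique[of s t X] assms(2-4) by (simp add: left_antipode_rev[OF assms(1)])
qed

theorem right_dual_of_antipode:
  assumes "bimonad C T" "right_antipode C T D s" "(M, r) \<in> objects (modules C T)"
  defines "P \<equiv> (M, r)" and "Q \<equiv> (dual D M, s M \<cdot>\<^bsub>C\<^esub> far T (right_dual_arr C D r))"
  shows "right_dual (modules C T) P Q
    (P \<otimes>\<^bsub>modules C T\<^esub> Q, ev D M, \<one>\<^bsub>modules C T\<^esub>) (\<one>\<^bsub>modules C T\<^esub>, coev D M, Q \<otimes>\<^bsub>modules C T\<^esub> P)"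
proof -
  interpret bimonad C T by (fact assms(1))
  have D: "right_duals C D"
    using assms(2) by (rule right_antipode.duals)
  interpret rev: bimonad_left_duals "rev_cat C" "rev_bimonad T" D
    using bimonad_rev[OF assms(1)] D
    by (simp add: bimonad_left_duals_def bimonad_left_duals_axioms_def left_duals_rev_cat)
  have "r \<in> arrows C"
    using assms(3) by (auto simp: mod_sel is_module_def mem_hom)
  then have "left_dual_arr (rev_cat C) D r = right_dual_arr C D r"
    by (rule left_dual_arr_rev_cat[OF monoidal_category_axioms D])
  then show ?thesis
    using rev.left_dual_of_antipode[of s M r] assms(2,3)
    unfolding P_def Q_def modules_rev left_dual_rev_cat left_antipode_rev[OF assms(1)] by simp
qed

theorem theorem3p8:
  fixes C :: "('o, 'a) moncat" and T :: "('o, 'a) bimonad_data"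
  assumes "monoidal_category C" and "bimonad C T"
  shows
    "(\<forall>L :: ('o, 'a) duals. left_duals C L \<longrightarrow>
        ((\<exists>s. left_antipode C T L s) \<longleftrightarrow> left_autonomous (modules C T)) \<and>
        (\<forall>s s'. left_antipode C T L s \<longrightarrow> left_antipode C T L s' \<longrightarrow>
           (\<forall>X \<in> Obj\<^bsub>C\<^esub>. s X = s' X)) \<and>
        (\<forall>s. left_antipode C T L s \<longrightarrow>
           (\<forall>M r. (M, r) \<in> Obj\<^bsub>modules C T\<^esub> \<longrightarrow>
              (let P = (M, r);
                   Q = (dual L M, s M \<cdot>\<^bsub>C\<^esub> far T (left_dual_arr C L r))
               in left_dual (modules C T) P Q
                    (Q \<otimes>\<^bsub>modules C T\<^esub> P, ev L M, \<one>\<^bsub>modules C T\<^esub>)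
                    (\<one>\<^bsub>modules C T\<^esub>, coev L M, P \<otimes>\<^bsub>modules C T\<^esub> Q)))))
     \<and>
     (\<forall>R :: ('o, 'a) duals. right_duals C R \<longrightarrow>
        ((\<exists>s. right_antipode C T R s) \<longleftrightarrow> right_autonomous (modules C T)) \<and>
        (\<forall>s s'. right_antipode C T R s \<longrightarrow> right_antipode C T R s' \<longrightarrow>
           (\<forall>X \<in> Obj\<^bsub>C\<^esub>. s X = s' X)) \<and>
        (\<forall>s. right_antipode C T R s \<longrightarrow>
           (\<forall>M r. (M, r) \<in> Obj\<^bsub>modules C T\<^esub> \<longrightarrow>
              (let P = (M, r);
                   Q = (dual R M, s M \<cdot>\<^bsub>C\<^esub> far T (right_dual_arr C R r))
               in right_dual (modules C T) P Q
                    (P \<otimes>\<^bsub>modules C T\<^esub> Q, ev R M, \<one>\<^bsub>modules C T\<^esub>)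
                    (\<one>\<^bsub>modules C T\<^esub>, coev R M, Q \<otimes>\<^bsub>modules C T\<^esub> P)))))"
proof (intro conjI allI impI ballI)
  fix L :: "('o, 'a) duals" assume "left_duals C L"
  then interpret bimonad_left_duals C T L
    using assms(2) by (simp add: bimonad_left_duals_def bimonad_left_duals_axioms_def)
  show "(\<exists>s. left_antipode C T L s) \<longleftrightarrow> left_autonomous (modules C T)"
    by (rule left_antipode_iff)
  show "s X = s' X"
    if "left_antipode C T L s" "left_antipode C T L s'" "X \<in> Obj\<^bsub>C\<^esub>" for s s' X
    using that by (rule antipode_unique)
  show "let P = (M, r); Q = (dual L M, s M \<cdot>\<^bsub>C\<^esub> far T (left_dual_arr C L r))
    in left_dual (modules C T) P Q
      (Q \<otimes>\<^bsub>modules C T\<^esub> P, ev L M, \<one>\<^bsub>modules C T\<^esub>) (\<one>\<^bsub>modules C T\<^esub>, coev L M, P \<otimes>\<^bsub>modules C T\<^esub> Q)"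
    if "left_antipode C T L s" "(M, r) \<in> Obj\<^bsub>modules C T\<^esub>" for s M r
    unfolding Let_def using that by (rule left_dual_of_antipode)
next
  fix R :: "('o, 'a) duals" assume R: "right_duals C R"
  show "(\<exists>s. right_antipode C T R s) \<longleftrightarrow> right_autonomous (modules C T)"
    using assms(2) R by (rule right_antipode_iff)
  show "s X = s' X"
    if "right_antipode C T R s" "right_antipode C T R s'" "X \<in> Obj\<^bsub>C\<^esub>" for s s' X
    using assms(2) that by (rule right_antipode_unique)
  show "let P = (M, r); Q = (dual R M, s M \<cdot>\<^bsub>C\<^esub> far T (right_dual_arr C R r))
    in right_dual (modules C T) P Q
      (P \<otimes>\<^bsub>modules C T\<^esub> Q, ev R M, \<one>\<^bsub>modules C T\<^esub>) (\<one>\<^bsub>modules C T\<^esub>, coev R M, Q \<otimes>\<^bsub>modules C T\<^esub> P)"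
    if "right_antipode C T R s" "(M, r) \<in> Obj\<^bsub>modules C T\<^esub>" for s M r
    unfolding Let_def using assms(2) that by (rule right_dual_of_antipode)
qed

end
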